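(* Let $T=[T_{ij}]_{i,j=0}^\infty\in\mathcal{S}(\mathcal{H})$. Then there exists a unique $T_1\in\mathcal{S}(\mathcal{H},\mathcal{D}_{T_{00}}^{\oplus N},\mathcal{D}_{T_{00}^*})$ such that $$T=\Phi(T_{00},0,\ldots)+\Phi(D_{T_{00}^*},0,\ldots)\,T_1S\,\bigl(I-\Phi(-T_{00}^*,0,\ldots)\,T_1S\bigr)^{-1}\,\Phi(D_{T_{00}},0,\ldots).$$
   Context: Fix an integer $N\ge 1$ and $\mathcal{H}=\mathbb{C}^N$. $\mathcal{H}_k$ ($k\ge 0$) is the Hilbert space $\mathbb{C}^{N^k}$ with orthonormal basis $\{e_\sigma\}$ indexed by the words $\sigma$ of length $k$ on the letters $1,\dots,N$, in lexicographic order; for $k\ge1$, $\mathcal{H}_k$ is identified with the direct sum of $N$ copies of $\mathcal{H}_{k-1}$, the $j$-th copy being spanned by the $e_{j\sigma}$, $|\sigma|=k-1$; correspondingly $\mathcal{H}_k\otimes\mathcal{E}=(\mathcal{H}_{k-1}\otimes\mathcal{E})^{\oplus N}$ for a Hilbert space $\mathcal{E}$. $R^{\oplus N}$ is the direct sum of $N$ copies of an operator (or space) $R$. For Hilbert spaces $\mathcal{E}_1,\mathcal{E}_2$, $\mathcal{S}(\mathcal{H},\mathcal{E}_1,\mathcal{E}_2)$ is the set of contractions $T=[T_{ij}]_{i,j=0}^\infty$ from $\bigoplus_{k=0}^\infty(\mathcal{H}_k\otimes\mathcal{E}_1)$ to $\bigoplus_{k=0}^\infty(\mathcal{H}_k\otimes\mathcal{E}_2)$,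 with $T_{ij}:\mathcal{H}_j\otimes\mathcal{E}_1\to\mathcal{H}_i\otimes\mathcal{E}_2$, that are upper triangular ($T_{ij}=0$ for $i>j$) and satisfy $$T_{ij}=T_{i-1,j-1}^{\oplus N}\qquad(1\le i\le j).\quad( * )$$ $\mathcal{S}(\mathcal{H})=\mathcal{S}(\mathcal{H},\mathbb{C},\mathbb{C})$; thus $T_{00}$ is a scalar with $|T_{00}|\le1$. An upper triangular operator satisfying $( * )$ is determined by its first row, and $\Phi([T_{0j}]_{j=0}^\infty)=T$ denotes the upper triangular operator satisfying $( * )$ with first row $[T_{0j}]_{j\geq 0}$; in particular $\Phi(c,0,0,\dots)$ is the block diagonal operator with diagonal blocks $c^{\oplus N^k}$, $k\ge0$. For a contraction $C$, $D_C=(I-C^*C)^{1/2}$ and $\mathcal{D}_C$ is the closure of the range of $D_C$. In the formula, $D_{T_{00}}$ is viewed as an operator $\mathbb{C}\to\mathcal{D}_{T_{00}}$, $D_{T_{00}^*}$ as an operator $\mathcal{D}_{T_{00}^*}\to\mathbb{C}$, and $T_{00}^*$ as an operator $\mathcal{D}_{T_{00}^*}\to\mathcal{D}_{T_{00}}$. $S$ is the translation operator $S:\bigoplus_{k=0}^\infty(\mathcal{H}_k\otimes\mathcal{D}_{T_{00}})\to\bigoplus_{k=0}^\infty(\mathcal{H}_k\otimes\mathcal{D}_{T_{00}}^{\oplus N})$, $S(x_0,x_1,x_2,\dots)=(x_1,x_2,\dots)$, where $\mathcal{H}_{k+1}\otimes\mathcal{D}_{T_{00}}$ is identified with $\mathcal{H}_k\otimes\mathcal{D}_{T_{00}}^{\oplus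 N}$ by letting $\sum_{i=1}^N e_{\sigma i}\otimes d_i$ correspond to $e_\sigma\otimes(d_1,\dots,d_N)$ for $|\sigma|=k$. Its matrix has identity entries in the positions $(i,i+1)$, $i\ge 0$, and zeros elsewhere. *)

theory Defs
  imports "HOL-Analysis.Analysis" "HOL-Library.Function_Algebras"
begin

section \<open>Complex Hilbert spaces\<close>

text \<open>
  The real inner product and the norm inherited from \<^class>\<open>real_inner\<close> are those induced by
  the complex inner product, which is linear in its first argument.
\<close>

class complex_hilbert = real_inner + complete_space +
  fixes scaleC :: "complex \<Rightarrow> 'a \<Rightarrow> 'a" (infixr "*\<^sub>C" 75)
    and cinner :: "'a \<Rightarrow> 'a \<Rightarrow> complex"
  assumes scaleC_add_right: "c *\<^sub>C (x + y) = c *\<^sub>C x + c *\<^sub>C y"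
    and scaleC_add_left: "(c + d) *\<^sub>C x = c *\<^sub>C x + d *\<^sub>C x"
    and scaleC_scaleC: "c *\<^sub>C d *\<^sub>C x = (c * d) *\<^sub>C x"
    and scaleC_of_real: "complex_of_real r *\<^sub>C x = r *\<^sub>R x"
    and cinner_add_left: "cinner (x + y) z = cinner x z + cinner y z"
    and cinner_scaleC_left: "cinner (c *\<^sub>C x) y = c * cinner x y"
    and cinner_commute: "cinner x y = cnj (cinner y x)"
    and inner_eq_Re_cinner: "x \<bullet> y = Re (cinner x y)"

instantiation complex :: complex_hilbert
begin

definition scaleC_complex :: "complex \<Rightarrow> complex \<Rightarrow> complex"
  where "scaleC_complex c z = c * z"

definition cinner_complex :: "complex \<Rightarrow> complex \<Rightarrow> complex"
  where "cinner_complex z w = z * cnj w"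

instance
  by standard
    (simp_all add: scaleC_complex_def cinner_complex_def algebra_simps scaleR_conv_of_real
      inner_complex_def)

end

instantiation vec :: (complex_hilbert, finite) complex_hilbert
begin

definition scaleC_vec :: "complex \<Rightarrow> 'a ^ 'b \<Rightarrow> 'a ^ 'b"
  where "scaleC_vec c v = (\<chi> i. c *\<^sub>C (v $ i))"

definition cinner_vec :: "'a ^ 'b \<Rightarrow> 'a ^ 'b \<Rightarrow> complex"
  where "cinner_vec v w = (\<Sum>i\<in>UNIV. cinner (v $ i) (w $ i))"

instance
proof
  fix x y :: "'a ^ 'b"
  show "cinner x y = cnj (cinner y x)"
    unfolding cinner_vec_def cnj_sum by (intro sum.cong refl cinner_commute)
qed (simp_all add: scaleC_vec_def cinner_vec_def vec_eq_iff scaleC_add_right scaleC_add_left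
      scaleC_scaleC scaleC_of_real cinner_add_left cinner_scaleC_left sum.distrib
      sum_distrib_left inner_vec_def inner_eq_Re_cinner)

end

definition cadjoint :: "('a::complex_hilbert \<Rightarrow> 'b::complex_hilbert) \<Rightarrow> 'b \<Rightarrow> 'a"
  where "cadjoint C = (THE B. \<forall>x y. cinner (C x) y = cinner x (B y))"

definition positive_op :: "('a::complex_hilbert \<Rightarrow> 'a) \<Rightarrow> bool"
  where "positive_op R \<longleftrightarrow> bounded_linear R \<and> (\<forall>c x. R (c *\<^sub>C x) = c *\<^sub>C R x) \<and>
    (\<forall>x. cinner (R x) x \<in> \<real>\<^sub>\<ge>\<^sub>0)"

definition defect_op :: "('a::complex_hilbert \<Rightarrow> 'b::complex_hilbert) \<Rightarrow> 'a \<Rightarrow> 'a"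
  where "defect_op C = (THE R. positive_op R \<and> (\<forall>x. R (R x) = x - cadjoint C (C x)))"

definition defect_space :: "('a::complex_hilbert \<Rightarrow> 'b::complex_hilbert) \<Rightarrow> 'a set"
  where "defect_space C = closure (range (defect_op C))"

text \<open>The direct sum of \<open>CARD('n)\<close> copies of a space.\<close>

definition copies :: "'e set \<Rightarrow> ('e ^ 'n) set"
  where "copies E = {v. \<forall>i. v $ i \<in> E}"


section \<open>The space \<open>\<Oplus>\<^sub>k (H\<^sub>k \<otimes> E)\<close>\<close>

text \<open>
  The \<open>N\<close> letters are the elements of a finite type \<open>'n\<close>, so that \<open>N = CARD('n) \<ge> 1\<close>.
  The coefficient space \<open>E\<close> is a closed complex subspace of the type \<open>'e\<close>.
  As \<open>H\<^sub>k\<close> has the orthonormal basis \<open>e\<^sub>\<sigma>\<close>, \<open>|\<sigma>| = k\<close>, an element \<open>\<Sum>\<^sub>\<sigma> e\<^sub>\<sigma> \<otimes> x\<^sub>\<sigma>\<close> of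
  the direct sum over all \<open>k\<close> is the square summable family \<open>(x\<^sub>\<sigma>)\<close> indexed by all words, and
  \<open>H\<^sub>k \<otimes> E\<close> is the set of families supported on the words of length \<open>k\<close>.
\<close>

definition fock :: "'e::complex_hilbert set \<Rightarrow> ('n::finite list \<Rightarrow> 'e) set"
  where "fock E = {x. (\<forall>w. x w \<in> E) \<and> (\<lambda>w. (norm (x w))\<^sup>2) summable_on UNIV}"

definition fock_norm :: "('n::finite list \<Rightarrow> 'e::complex_hilbert) \<Rightarrow> real"
  where "fock_norm x = sqrt (\<Sum>\<^sub>\<infinity>w. (norm (x w))\<^sup>2)"

definition level :: "nat \<Rightarrow> 'e::complex_hilbert set \<Rightarrow> ('n::finite list \<Rightarrow> 'e) set"
  where "level k E = {x. (\<forall>w. x w \<in> E) \<and> (\<forall>w. length w \<noteq> k \<longrightarrow> x w = 0)}"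

definition level_proj :: "nat \<Rightarrow> ('n::finite list \<Rightarrow> 'e::complex_hilbert) \<Rightarrow> 'n list \<Rightarrow> 'e"
  where "level_proj k x = (\<lambda>w. if length w = k then x w else 0)"

text \<open>\<open>e\<^sub>\<emptyset> \<otimes> d\<close>, which identifies \<open>E\<close> with \<open>H\<^sub>0 \<otimes> E\<close>:\<close>

definition vacuum :: "'e::complex_hilbert \<Rightarrow> 'n::finite list \<Rightarrow> 'e"
  where "vacuum d = (\<lambda>w. if w = [] then d else 0)"


section \<open>Operators\<close>

text \<open>
  An operator defined on \<^term>\<open>fock E\<close> is extended by \<open>0\<close> to all families.  Sums, differences and
  composites of such operators are again of this form, and two of them are equal as HOL functions
  exactly if they agree on \<^term>\<open>fock E\<close>.
\<close>

definition bounded_ops ::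
    "'e::complex_hilbert set \<Rightarrow> 'f::complex_hilbert set \<Rightarrow>
      (('n::finite list \<Rightarrow> 'e) \<Rightarrow> ('n list \<Rightarrow> 'f)) set"
  where "bounded_ops E F = {T.
    (\<forall>x\<in>fock E. T x \<in> fock F) \<and>
    (\<forall>x. x \<notin> fock E \<longrightarrow> T x = 0) \<and>
    (\<forall>x\<in>fock E. \<forall>y\<in>fock E. T (x + y) = T x + T y) \<and>
    (\<forall>c. \<forall>x\<in>fock E. T (\<lambda>w. c *\<^sub>C x w) = (\<lambda>w. c *\<^sub>C T x w)) \<and>
    (\<exists>K. \<forall>x\<in>fock E. fock_norm (T x) \<le> K * fock_norm x)}"

definition id_op :: "'e::complex_hilbert set \<Rightarrow> ('n::finite list \<Rightarrow> 'e) \<Rightarrow> 'n list \<Rightarrow> 'e"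
  where "id_op E x = (if x \<in> fock E then x else 0)"

definition inverse_ops ::
    "'e::complex_hilbert set \<Rightarrow> (('n::finite list \<Rightarrow> 'e) \<Rightarrow> ('n list \<Rightarrow> 'e)) \<Rightarrow>
      (('n list \<Rightarrow> 'e) \<Rightarrow> ('n list \<Rightarrow> 'e)) \<Rightarrow> bool"
  where "inverse_ops E A B \<longleftrightarrow> A \<in> bounded_ops E E \<and> B \<in> bounded_ops E E \<and>
    A \<circ> B = id_op E \<and> B \<circ> A = id_op E"

definition invertible_op ::
    "'e::complex_hilbert set \<Rightarrow> (('n::finite list \<Rightarrow> 'e) \<Rightarrow> ('n list \<Rightarrow> 'e)) \<Rightarrow> bool"
  where "invertible_op E A \<longleftrightarrow> (\<exists>B. inverse_ops E A B)"

definition inverse_op ::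
    "'e::complex_hilbert set \<Rightarrow> (('n::finite list \<Rightarrow> 'e) \<Rightarrow> ('n list \<Rightarrow> 'e)) \<Rightarrow>
      ('n list \<Rightarrow> 'e) \<Rightarrow> ('n list \<Rightarrow> 'e)"
  where "inverse_op E A = (THE B. inverse_ops E A B)"

text \<open>The matrix entry \<open>T\<^sub>i\<^sub>j\<close>, to be applied to elements of \<open>H\<^sub>j \<otimes> E\<close>:\<close>

definition entry ::
    "(('n::finite list \<Rightarrow> 'e::complex_hilbert) \<Rightarrow> ('n list \<Rightarrow> 'f::complex_hilbert)) \<Rightarrow>
      nat \<Rightarrow> nat \<Rightarrow> ('n list \<Rightarrow> 'e) \<Rightarrow> ('n list \<Rightarrow> 'f)"
  where "entry T i j x = level_proj i (T (level_proj j x))"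

text \<open>\<open>T\<^sub>0\<^sub>0\<close>, after the identification of \<open>H\<^sub>0 \<otimes> E\<close> with \<open>E\<close>:\<close>

definition entry00 ::
    "(('n::finite list \<Rightarrow> 'e::complex_hilbert) \<Rightarrow> ('n list \<Rightarrow> 'f::complex_hilbert)) \<Rightarrow> 'e \<Rightarrow> 'f"
  where "entry00 T d = entry T 0 0 (vacuum d) []"

text \<open>
  The direct sum of \<open>N\<close> copies of an operator \<open>R\<close> from \<open>H\<^sub>j \<otimes> E\<close> to \<open>H\<^sub>i \<otimes> F\<close>, which maps
  \<open>H\<^sub>j\<^sub>+\<^sub>1 \<otimes> E\<close> to \<open>H\<^sub>i\<^sub>+\<^sub>1 \<otimes> F\<close>: the copies are indexed by the first letter of a word.
\<close>

definition op_copies ::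
    "(('n::finite list \<Rightarrow> 'e::complex_hilbert) \<Rightarrow> ('n list \<Rightarrow> 'f::complex_hilbert)) \<Rightarrow>
      ('n list \<Rightarrow> 'e) \<Rightarrow> ('n list \<Rightarrow> 'f)"
  where "op_copies R x = (\<lambda>w. case w of [] \<Rightarrow> 0 | a # v \<Rightarrow> R (\<lambda>u. x (a # u)) v)"

definition upper_triangular ::
    "'e::complex_hilbert set \<Rightarrow>
      (('n::finite list \<Rightarrow> 'e) \<Rightarrow> ('n list \<Rightarrow> 'f::complex_hilbert)) \<Rightarrow> bool"
  where "upper_triangular E T \<longleftrightarrow> (\<forall>i j. j < i \<longrightarrow> (\<forall>x\<in>level j E. entry T i j x = 0))"

definition shift_invariant ::
    "'e::complex_hilbert set \<Rightarrow>
      (('n::finite list \<Rightarrow> 'e) \<Rightarrow> ('n list \<Rightarrow> 'f::complex_hilbert)) \<Rightarrow> bool"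
  where "shift_invariant E T \<longleftrightarrow> (\<forall>i j. 1 \<le> i \<and> i \<le> j \<longrightarrow>
    (\<forall>x\<in>level j E. entry T i j x = op_copies (entry T (i - 1) (j - 1)) x))"

definition schur_class ::
    "'e::complex_hilbert set \<Rightarrow> 'f::complex_hilbert set \<Rightarrow>
      (('n::finite list \<Rightarrow> 'e) \<Rightarrow> ('n list \<Rightarrow> 'f)) set"
  where "schur_class E F = {T \<in> bounded_ops E F.
    (\<forall>x\<in>fock E. fock_norm (T x) \<le> fock_norm x) \<and> upper_triangular E T \<and> shift_invariant E T}"

text \<open>
  The map \<open>\<Phi>\<close>.  The \<open>j\<close>-th entry of the row \<open>r\<close> is an operator from \<open>H\<^sub>j \<otimes> E\<close> to
  \<open>F = H\<^sub>0 \<otimes> F\<close>.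
\<close>

definition Phi ::
    "'e::complex_hilbert set \<Rightarrow> 'f::complex_hilbert set \<Rightarrow>
      (nat \<Rightarrow> ('n::finite list \<Rightarrow> 'e) \<Rightarrow> 'f) \<Rightarrow> ('n list \<Rightarrow> 'e) \<Rightarrow> ('n list \<Rightarrow> 'f)"
  where "Phi E F r = (THE T. T \<in> bounded_ops E F \<and> upper_triangular E T \<and> shift_invariant E T \<and>
    (\<forall>j. \<forall>x\<in>level j E. entry T 0 j x = vacuum (r j x)))"

text \<open>The row \<open>(C, 0, 0, \<dots>)\<close>:\<close>

definition row0 ::
    "('e::complex_hilbert \<Rightarrow> 'f::complex_hilbert) \<Rightarrow> nat \<Rightarrow> ('n::finite list \<Rightarrow> 'e) \<Rightarrow> 'f"
  where "row0 C j x = (if j = 0 then C (x []) else 0)"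

text \<open>
  The translation operator.  It drops the component in \<open>H\<^sub>0 \<otimes> E\<close> and sends \<open>e\<^sub>\<sigma>\<^sub>i \<otimes> d\<^sub>i\<close>, summed
  over the last letter \<open>i\<close>, to \<open>e\<^sub>\<sigma> \<otimes> (d\<^sub>1, \<dots>, d\<^sub>N)\<close>.
\<close>

definition translation ::
    "'e::complex_hilbert set \<Rightarrow> ('n::finite list \<Rightarrow> 'e) \<Rightarrow> ('n list \<Rightarrow> 'e ^ 'n)"
  where "translation E x = (if x \<in> fock E then (\<lambda>w. \<chi> i. x (w @ [i])) else 0)"

end

(*
  An upper triangular shift invariant operator is exactly one that commutes with the adjoints
  L_a^* of the left creation operators: (T x)(a w) = (T (x(a .)))(w).  This condition passes to
  sums, composites and inverses.

  Put c = T_00.  If |c| = 1, testing the contraction T on r conj(c) t e_0 + x shows that its first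
  row is (c, 0, 0, ...), so T = c, and T_1 acts between zero spaces.  If |c| < 1, the formula is
  equivalent to T_1 S = Z with the Moebius transform Z = (1 - conj(c) T)^-1 (T - c), where the
  inverse is a Neumann series; Z is a contraction with Z_00 = 0.  Uniqueness follows since S is
  surjective, and T_1 = Z S^* gives existence since S^* is an isometry and Z vanishes on
  the vacuum e_0.
*)

theory Submission
  imports Defs
begin

section \<open>Square summable families\<close>

text \<open>Why the formula amounts to a Moebius transform: put X = T_1 S and d^2 = 1 - |c|^2.
  Scalars commute with X, so it reads T = c + d X (I + conj(c) X)^-1 d. Multiplying by I + conj(c) X
  on the right gives T (I + conj(c) X) = c + (|c|^2 + d^2) X = c + X, that is, (I - conj(c) T) X = T
  - c. Conversely, for X = Z one finds I + conj(c) Z = d^2 (I - conj(c) T)^-1, so the inverse in the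
  formula exists and is explicit. Two obstacles shape the proof. The block conditions speak of one
  level at a time, and multiplying such matrices would lead to infinite sums of entries; the
  intertwining identity compares single coordinates instead. In the same spirit the Neumann series
  is summed word by word and norms are estimated on finite sets of words. Moreover, S regroups words
  by their last letter, while L_a^* removes the first one. The two collide at words of length one,
  so S^* does not intertwine; its error is a multiple of the vacuum, which T - c annihilates, and
  therefore Z S^* does intertwine.\<close>

lemma cinner_scaleC_right:
  "cinner x (c *\<^sub>C y) = cnj c * cinner x (y :: 'a::complex_hilbert)"
  by (metis cinner_commute cinner_scaleC_left complex_cnj_mult)

text \<open>\<open>real_inner\<close> ties the norm to real scaling only; complex scaling reaches it
  through \<open>cinner\<close>, whose real part on the diagonal is the squared norm.\<close>

lemma norm_scaleC: "norm (c *\<^sub>C x) = cmod c * norm (x :: 'a::complex_hilbert)"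
proof -
  have "cinner (c *\<^sub>C x) (c *\<^sub>C x) = (c * cnj c) * cinner x x"
    by (simp add: cinner_scaleC_left cinner_scaleC_right)
  also have "\<dots> = complex_of_real ((cmod c)\<^sup>2) * cinner x x"
    by (simp only: complex_norm_square)
  finally have "(norm (c *\<^sub>C x))\<^sup>2 = (cmod c * norm x)\<^sup>2"
    by (simp add: power2_norm_eq_inner inner_eq_Re_cinner power_mult_distrib)
  then show ?thesis
    by (simp add: power2_eq_iff_nonneg)
qed

lemma L2_set_le_fock_norm:
  assumes "x \<in> fock E" "finite F"
  shows "L2_set (\<lambda>w. norm (x w)) F \<le> fock_norm x"
  using assms unfolding L2_set_def fock_norm_def fock_def
  by (auto intro!: real_sqrt_le_mono finite_sum_le_infsum)

lemma norm_le_fock_norm: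
  assumes "x \<in> fock E"
  shows "norm (x w) \<le> fock_norm x"
  using L2_set_le_fock_norm[OF assms, of "{w}"] by simp

lemma fock_norm_nonneg [simp]: "0 \<le> fock_norm x"
  by (simp add: fock_norm_def infsum_nonneg)

text \<open>The entry point for norm estimates: a bound on finite sets of words, where
  \<open>L2_set\<close> offers Minkowski's inequality, yields membership and the norm bound at
  once.\<close>

lemma fockI:
  fixes x :: "'n::finite list \<Rightarrow> 'e::complex_hilbert"
  assumes E: "\<And>w. x w \<in> E" and K: "\<And>F. finite F \<Longrightarrow> L2_set (\<lambda>w. norm (x w)) F \<le> K"
  shows "x \<in> fock E" and "fock_norm x \<le> K"
proof -
  have K0: "0 \<le> K" using K[of "{}"] by simp
  have b: "(\<Sum>w\<in>F. (norm (x w))\<^sup>2) \<le> K\<^sup>2" if "finite F" for F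
    using K[OF that] K0 unfolding L2_set_def by (simp add: sqrt_le_D)
  have s: "(\<lambda>w. (norm (x w))\<^sup>2) summable_on UNIV"
    by (rule nonneg_bdd_above_summable_on) (auto intro!: bdd_aboveI2[where M = "K\<^sup>2"] b)
  then show "x \<in> fock E" using E by (simp add: fock_def)
  have "(\<Sum>\<^sub>\<infinity>w. (norm (x w))\<^sup>2) \<le> K\<^sup>2"
    by (rule infsum_le_finite_sums[OF s]) (use b in auto)
  then show "fock_norm x \<le> K"
    unfolding fock_norm_def using K0 by (simp add: real_le_lsqrt infsum_nonneg)
qed

lemma fock_D: "x \<in> fock E \<Longrightarrow> x w \<in> E"
  by (simp add: fock_def)

lemma fock_iff: "x \<in> fock E \<longleftrightarrow> x \<in> fock UNIV \<and> (\<forall>w. x w \<in> E)"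
  by (auto simp: fock_def)

lemma fock_add:
  assumes "x \<in> fock UNIV" "y \<in> fock UNIV"
  shows "x + y \<in> fock UNIV" and "fock_norm (x + y) \<le> fock_norm x + fock_norm y"
proof -
  have b: "L2_set (\<lambda>w. norm ((x + y) w)) F \<le> fock_norm x + fock_norm y" if "finite F" for F
  proof -
    have "L2_set (\<lambda>w. norm ((x + y) w)) F \<le> L2_set (\<lambda>w. norm (x w) + norm (y w)) F"
      by (rule L2_set_mono) (auto intro: norm_triangle_ineq)
    also have "\<dots> \<le> L2_set (\<lambda>w. norm (x w)) F + L2_set (\<lambda>w. norm (y w)) F"
      by (rule L2_set_triangle_ineq)
    also have "\<dots> \<le> fock_norm x + fock_norm y"
      by (intro add_mono L2_set_le_fock_norm[OF assms(1) that] L2_set_le_fock_norm[OF assms(2) that])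
    finally show ?thesis .
  qed
  show "x + y \<in> fock UNIV" and "fock_norm (x + y) \<le> fock_norm x + fock_norm y"
    using fockI[of "x + y" UNIV, OF UNIV_I b] by auto
qed

lemma fock_scaleC:
  assumes "x \<in> fock UNIV"
  shows "(\<lambda>w. c *\<^sub>C x w) \<in> fock UNIV" and "fock_norm (\<lambda>w. c *\<^sub>C x w) \<le> cmod c * fock_norm x"
proof -
  have b: "L2_set (\<lambda>w. norm (c *\<^sub>C x w)) F \<le> cmod c * fock_norm x" if "finite F" for F
    using L2_set_le_fock_norm[OF assms that]
    by (simp add: norm_scaleC L2_set_right_distrib[symmetric] mult_left_mono)
  show "(\<lambda>w. c *\<^sub>C x w) \<in> fock UNIV" and "fock_norm (\<lambda>w. c *\<^sub>C x w) \<le> cmod c * fock_norm x"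
    using fockI[of "\<lambda>w. c *\<^sub>C x w" UNIV, OF UNIV_I b] by auto
qed

lemmas fock_mult = fock_scaleC[where 'b = complex, unfolded scaleC_complex_def]

lemma fock_zero: "0 \<in> E \<Longrightarrow> 0 \<in> fock E" "fock_norm 0 = 0"
  by (simp_all add: fock_def fock_norm_def)

lemma fock_diff:
  fixes x y :: "'n::finite list \<Rightarrow> complex"
  assumes "x \<in> fock UNIV" "y \<in> fock UNIV"
  shows "x - y \<in> fock UNIV"
proof -
  have "x - y = x + (\<lambda>w. - 1 * y w)" by auto
  then show ?thesis using fock_add(1)[OF assms(1) fock_mult(1)[OF assms(2), of "- 1"]] by metis
qed

lemma fock_drop_letter:
  fixes x :: "'n::finite list \<Rightarrow> 'e::complex_hilbert"
  assumes "x \<in> fock E"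
  shows "(\<lambda>u. x (a # u)) \<in> fock E" and "fock_norm (\<lambda>u. x (a # u)) \<le> fock_norm x"
proof -
  have b: "L2_set (\<lambda>u. norm (x (a # u))) F \<le> fock_norm x" if "finite F" for F
  proof -
    have "L2_set (\<lambda>u. norm (x (a # u))) F = L2_set (\<lambda>w. norm (x w)) ((#) a ` F)"
      unfolding L2_set_def by (subst sum.reindex) (auto simp: inj_on_def)
    also have "\<dots> \<le> fock_norm x"
      by (rule L2_set_le_fock_norm[OF assms]) (use that in auto)
    finally show ?thesis .
  qed
  show "(\<lambda>u. x (a # u)) \<in> fock E" and "fock_norm (\<lambda>u. x (a # u)) \<le> fock_norm x"
    using fockI[of "\<lambda>u. x (a # u)", OF fock_D[OF assms] b] by auto
qed

section \<open>Levels, truncation by word length, and density\<close>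

lemma finite_words: "finite {w :: 'n::finite list. length w < n}"
proof -
  have "finite {w :: 'n list. set w \<subseteq> UNIV \<and> length w \<le> n}"
    by (rule finite_lists_length_le) simp
  then show ?thesis by (rule finite_subset[rotated]) auto
qed

lemma level_in_fock:
  fixes x :: "'n::finite list \<Rightarrow> 'e::complex_hilbert"
  assumes "x \<in> level j E"
  shows "x \<in> fock E"
proof -
  have "(\<lambda>w. (norm (x w))\<^sup>2) summable_on {w. length w < Suc j}"
    using finite_words by (rule summable_on_finite)
  then have "(\<lambda>w. (norm (x w))\<^sup>2) summable_on UNIV"
    by (rule summable_on_cong_neutral[THEN iffD1, rotated -1])
      (use assms in \<open>auto simp: level_def\<close>)
  then show ?thesis using assms by (auto simp: level_def fock_def)
qed

text \<open>The alphabet is finite, so the words shorter than \<open>n\<close> form finite sets, and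
  these eventually contain any given finite set. Sums over them therefore converge to the whole sum,
  and the tail is the square root of the remainder.\<close>

lemma fock_tail:
  fixes x :: "'n::finite list \<Rightarrow> 'e::complex_hilbert"
  assumes "x \<in> fock E"
  shows "(\<lambda>n. fock_norm (\<lambda>w. if length w < n then 0 else x w)) \<longlonglongrightarrow> 0"
proof -
  define f where "f = (\<lambda>w. (norm (x w))\<^sup>2)"
  have s: "f summable_on A" for A
    using assms summable_on_subset_banach[of f UNIV A] by (auto simp: fock_def f_def)
  have fil: "filterlim (\<lambda>n. {w :: 'n list. length w < n}) (finite_subsets_at_top UNIV) sequentially"
  proof (subst filterlim_finite_subsets_at_top, intro allI impI)
    fix X :: "'n list set" assume "finite X \<and> X \<subseteq> UNIV"
    then have "\<forall>w\<in>X. length w < Suc (Max (length ` X))"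
      by (auto simp: less_Suc_eq_le)
    then have "\<forall>\<^sub>F n in sequentially. X \<subseteq> {w. length w < n}"
      by (intro eventually_sequentiallyI[of "Suc (Max (length ` X))"]) force
    then show "\<forall>\<^sub>F n in sequentially. finite {w :: 'n list. length w < n} \<and>
        X \<subseteq> {w. length w < n} \<and> {w :: 'n list. length w < n} \<subseteq> UNIV"
      by (simp add: finite_words)
  qed
  have "(f has_sum infsum f UNIV) UNIV" using s by (rule has_sum_infsum)
  then have lim: "(\<lambda>n. sum f {w. length w < n}) \<longlonglongrightarrow> infsum f UNIV"
    unfolding has_sum_def by (rule filterlim_compose[OF _ fil])
  have eq: "fock_norm (\<lambda>w. if length w < n then 0 else x w)
      = sqrt (infsum f UNIV - sum f {w. length w < n})" for n
  proof -
    have "(\<Sum>\<^sub>\<infinity>w. (norm (if length w < n then 0 else x w))\<^sup>2)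
        = infsum f (UNIV - {w. length w < n})"
      by (rule infsum_cong_neutral) (auto simp: f_def)
    also have "\<dots> = infsum f UNIV - infsum f {w. length w < n}"
      by (rule infsum_Diff) (use s in auto)
    finally show ?thesis by (simp add: fock_norm_def infsum_finite finite_words)
  qed
  have "(\<lambda>n. sqrt (infsum f UNIV - sum f {w. length w < n})) \<longlonglongrightarrow> sqrt (infsum f UNIV - infsum f UNIV)"
    by (intro tendsto_intros lim)
  then show ?thesis by (simp add: eq)
qed

text \<open>Serves to show that an operator is determined by its matrix: \<open>G\<close> will be
  the difference of two coordinate maps. A truncation is a finite sum of vectors from single levels,
  so \<open>G\<close> sees only the tail of \<open>x\<close>, which tends to 0 in norm.\<close>

lemma fock_density:
  fixes G :: "('n::finite list \<Rightarrow> 'e::complex_hilbert) \<Rightarrow> 'b::real_normed_vector"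
  assumes E: "0 \<in> E"
    and add: "\<And>x y. x \<in> fock E \<Longrightarrow> y \<in> fock E \<Longrightarrow> G (x + y) = G x + G y"
    and bound: "\<And>x. x \<in> fock E \<Longrightarrow> norm (G x) \<le> K * fock_norm x"
    and level: "\<And>j x. x \<in> level j E \<Longrightarrow> G x = 0"
    and x: "x \<in> fock E"
  shows "G x = 0"
proof -
  define tr where "tr n = (\<lambda>w. if length w < n then x w else 0)" for n
  define tl where "tl n = (\<lambda>w. if length w < n then 0 else x w)" for n
  have xE: "x w \<in> E" for w using x by (rule fock_D)
  have trE: "tr n \<in> fock E" for n
    using x by (auto simp: tr_def fock_def E intro: summable_on_comparison_test)
  have tlE: "tl n \<in> fock E" for n
    using x by (auto simp: tl_def fock_def E intro: summable_on_comparison_test)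
  have G0: "G 0 = 0" by (rule level[of _ 0]) (simp add: level_def E)
  have Gtr: "G (tr n) = 0" for n
  proof (induction n)
    case 0
    have "tr 0 = 0" by (auto simp: tr_def)
    then show ?case using G0 by argo
  next
    case (Suc n)
    have lv: "level_proj n x \<in> level n E" by (auto simp: level_proj_def level_def E xE)
    have "tr (Suc n) = tr n + level_proj n x"
      by (auto simp: tr_def level_proj_def less_Suc_eq)
    then have "G (tr (Suc n)) = G (tr n) + G (level_proj n x)"
      using add[OF trE[of n] level_in_fock[OF lv]] by argo
    then show ?case using Suc level[OF lv] by simp
  qed
  have "x = tr n + tl n" for n by (auto simp: tr_def tl_def)
  then have "G x = G (tl n)" for n using add[OF trE tlE, of n n] Gtr by (metis add_0)
  then have "norm (G x) \<le> K * fock_norm (tl n)" for n using bound[OF tlE] by simp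
  moreover have "(\<lambda>n. K * fock_norm (tl n)) \<longlonglongrightarrow> K * 0"
    unfolding tl_def by (intro tendsto_intros fock_tail[OF x])
  ultimately have "norm (G x) \<le> K * 0" by (intro LIMSEQ_le_const[of _ "K * 0"]) auto
  then show ?thesis by simp
qed


section \<open>Upper triangular shift invariant operators\<close>

lemma bounded_opsD:
  assumes "T \<in> bounded_ops E F"
  shows "x \<in> fock E \<Longrightarrow> T x \<in> fock F" "x \<notin> fock E \<Longrightarrow> T x = 0"
    "x \<in> fock E \<Longrightarrow> y \<in> fock E \<Longrightarrow> T (x + y) = T x + T y"
    "x \<in> fock E \<Longrightarrow> T (\<lambda>w. c *\<^sub>C x w) = (\<lambda>w. c *\<^sub>C T x w)"
  using assms by (auto simp: bounded_ops_def)

lemma bounded_ops_zero: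
  fixes T :: "('n::finite list \<Rightarrow> 'e::complex_hilbert) \<Rightarrow> ('n list \<Rightarrow> 'f::complex_hilbert)"
  assumes "T \<in> bounded_ops E F"
  shows "T 0 = 0"
proof (cases "(0 :: 'n list \<Rightarrow> 'e) \<in> fock E")
  case True
  from bounded_opsD(3)[OF assms True True] show ?thesis by simp
qed (use assms bounded_opsD(2) in blast)

lemma bounded_ops_bound:
  fixes T :: "('n::finite list \<Rightarrow> 'e::complex_hilbert) \<Rightarrow> ('n list \<Rightarrow> 'f::complex_hilbert)"
  assumes "T \<in> bounded_ops E F"
  obtains K where "0 \<le> K" "\<And>x w. x \<in> fock E \<Longrightarrow> norm (T x w) \<le> K * fock_norm x"
proof -
  obtain K where K: "\<And>x. x \<in> fock E \<Longrightarrow> fock_norm (T x) \<le> K * fock_norm x"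
    using assms unfolding bounded_ops_def by blast
  have "norm (T x w) \<le> \<bar>K\<bar> * fock_norm x" if "x \<in> fock E" for x :: "'n list \<Rightarrow> 'e" and w
  proof -
    have "norm (T x w) \<le> fock_norm (T x)"
      by (rule norm_le_fock_norm[OF bounded_opsD(1)[OF assms that]])
    also have "\<dots> \<le> K * fock_norm x" by (rule K[OF that])
    also have "\<dots> \<le> \<bar>K\<bar> * fock_norm x" by (intro mult_right_mono) auto
    finally show ?thesis .
  qed
  then show ?thesis using that[of "\<bar>K\<bar>"] by auto
qed

text \<open>
  In terms of the left creation operators \<open>L\<^sub>a\<close>, this says \<open>L\<^sub>a\<^sup>* T = T L\<^sub>a\<^sup>*\<close>.
\<close>

definition intertwining ::
    "'e::complex_hilbert set \<Rightarrow>
      (('n::finite list \<Rightarrow> 'e) \<Rightarrow> ('n list \<Rightarrow> 'f::complex_hilbert)) \<Rightarrow> bool"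
  where "intertwining E T \<longleftrightarrow> (\<forall>x\<in>fock E. \<forall>a w. T x (a # w) = T (\<lambda>u. x (a # u)) w)"

lemma intertwiningD:
  "intertwining E T \<Longrightarrow> x \<in> fock E \<Longrightarrow> T x (a # w) = T (\<lambda>u. x (a # u)) w"
  by (simp add: intertwining_def)

lemma entry_level: "x \<in> level j E \<Longrightarrow> entry T i j x = level_proj i (T x)"
proof -
  assume "x \<in> level j E"
  then have "level_proj j x = x" by (auto simp: level_def level_proj_def)
  then show ?thesis by (simp add: entry_def)
qed

lemma level_drop_letter:
  assumes "x \<in> level j E"
  shows "j = 0 \<Longrightarrow> (\<lambda>u. x (a # u)) = 0" "j > 0 \<Longrightarrow> (\<lambda>u. x (a # u)) \<in> level (j - 1) E"
  using assms by (auto simp: level_def)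

lemma upper_triangularD:
  fixes T :: "('n::finite list \<Rightarrow> 'e::complex_hilbert) \<Rightarrow> ('n list \<Rightarrow> 'f::complex_hilbert)"
  assumes "upper_triangular E T" "x \<in> level j E" "j < length w"
  shows "T x w = 0"
proof -
  have "level_proj (length w) (T x) = 0"
    using assms entry_level[OF assms(2)] by (metis upper_triangular_def)
  from fun_cong[OF this, of w] show ?thesis by (simp add: level_proj_def)
qed

text \<open>The block condition read at one word \<open>a # w\<close>: this word lies in row
  \<open>i = length w + 1\<close>, so \<open>i \<le> j\<close> becomes
  \<open>length w < j\<close>.\<close>

lemma shift_invariant_iff:
  fixes T :: "('n::finite list \<Rightarrow> 'e::complex_hilbert) \<Rightarrow> ('n list \<Rightarrow> 'f::complex_hilbert)"
  shows
  "shift_invariant E T \<longleftrightarrow> (\<forall>j x a w. x \<in> level j E \<longrightarrow> length w < j \<longrightarrow>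
     T x (a # w) = T (\<lambda>u. x (a # u)) w)" (is "?L \<longleftrightarrow> ?R")
proof
  assume L: ?L
  show ?R
  proof (intro allI impI)
    fix j and x :: "'n list \<Rightarrow> 'e" and a :: 'n and w :: "'n list" assume x: "x \<in> level j E" and w: "length w < j"
    have "entry T (Suc (length w)) j x = op_copies (entry T (length w) (j - 1)) x"
      using L x w by (force simp: shift_invariant_def)
    from fun_cong[OF this, of "a # w"]
    show "T x (a # w) = T (\<lambda>u. x (a # u)) w"
      using entry_level[OF level_drop_letter(2)[OF x, of a], where T = T] w
      by (simp add: entry_level[OF x] op_copies_def level_proj_def)
  qed
next
  assume R: ?R
  show ?L
    unfolding shift_invariant_def
  proof (intro allI impI ballI ext)
    fix i j and x :: "'n list \<Rightarrow> 'e" and w assume ij: "1 \<le> i \<and> i \<le> j" and x: "x \<in> level j E"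
    show "entry T i j x w = op_copies (entry T (i - 1) (j - 1)) x w"
    proof (cases w)
      case Nil
      then show ?thesis using ij by (simp add: entry_level[OF x] op_copies_def level_proj_def)
    next
      case (Cons a v)
      have "(\<lambda>u. x (a # u)) \<in> level (j - 1) E" using level_drop_letter(2)[OF x] ij by simp
      then show ?thesis using Cons R x ij
        by (auto simp: entry_level[OF x] op_copies_def entry_level level_proj_def)
    qed
  qed
qed

text \<open>From right to left, triangularity comes from removing letters: a vector of level
  \<open>j\<close> becomes 0 after \<open>j + 1\<close> removals, before a longer word is used up.
  From left to right, shift invariance gives the identity on and above the diagonal, triangularity
  makes both sides 0 below it, and density carries it from the levels to
  \<open>fock E\<close>.\<close>

lemma intertwining_iff:
  fixes T :: "('n::finite list \<Rightarrow> 'e::complex_hilbert) \<Rightarrow> ('n list \<Rightarrow> 'f::complex_hilbert)"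
  assumes T: "T \<in> bounded_ops E F" and E: "0 \<in> E"
  shows "upper_triangular E T \<and> shift_invariant E T \<longleftrightarrow> intertwining E T"
proof
  assume I: "intertwining E T"
  have "T x w = 0" if "x \<in> level j E" "j < length w" for x :: "'n list \<Rightarrow> 'e" and w j
    using that
  proof (induction w arbitrary: x j)
    case (Cons a w)
    have eq: "T x (a # w) = T (\<lambda>u. x (a # u)) w"
      by (rule intertwiningD[OF I level_in_fock[OF Cons.prems(1)]])
    show ?case
    proof (cases "j = 0")
      case True
      then show ?thesis
        using eq level_drop_letter(1)[OF Cons.prems(1)] bounded_ops_zero[OF T] by simp
    next
      case False
      then show ?thesis
        using eq level_drop_letter(2)[OF Cons.prems(1)] Cons.IH[of _ "j - 1"] Cons.prems(2) by simp
    qed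
  qed simp
  then have "upper_triangular E T"
    by (auto simp: upper_triangular_def entry_level level_proj_def)
  moreover have "shift_invariant E T"
    by (auto simp: shift_invariant_iff intertwiningD[OF I level_in_fock])
  ultimately show "upper_triangular E T \<and> shift_invariant E T" ..
next
  assume U: "upper_triangular E T \<and> shift_invariant E T"
  obtain K where K: "0 \<le> K" "\<And>x w. x \<in> fock E \<Longrightarrow> norm (T x w) \<le> K * fock_norm x"
    using bounded_ops_bound[OF T] by blast
  show "intertwining E T"
    unfolding intertwining_def
  proof (intro ballI allI)
    fix x :: "'n list \<Rightarrow> 'e" and a w assume x: "x \<in> fock E"
    \<comment> \<open>With \<open>a\<close> and \<open>w\<close> fixed, the difference is a bounded
      additive map of \<open>x\<close>, as density requires.\<close>
    have "T x (a # w) - T (\<lambda>u. x (a # u)) w = 0"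
    proof (rule fock_density[OF E _ _ _ x])
      fix x y :: "'n list \<Rightarrow> 'e" assume x: "x \<in> fock E" and y: "y \<in> fock E"
      have "(\<lambda>u. (x + y) (a # u)) = (\<lambda>u. x (a # u)) + (\<lambda>u. y (a # u))" by auto
      then show "T (x + y) (a # w) - T (\<lambda>u. (x + y) (a # u)) w
        = (T x (a # w) - T (\<lambda>u. x (a # u)) w) + (T y (a # w) - T (\<lambda>u. y (a # u)) w)"
        using bounded_opsD(3)[OF T x y]
          bounded_opsD(3)[OF T fock_drop_letter(1)[OF x] fock_drop_letter(1)[OF y]]
        by simp
    next
      fix x :: "'n list \<Rightarrow> 'e" assume x: "x \<in> fock E"
      have "norm (T x (a # w) - T (\<lambda>u. x (a # u)) w)
          \<le> norm (T x (a # w)) + norm (T (\<lambda>u. x (a # u)) w)"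
        by (rule norm_triangle_ineq4)
      also have "\<dots> \<le> K * fock_norm x + K * fock_norm (\<lambda>u. x (a # u))"
        by (intro add_mono K(2) x fock_drop_letter)
      also have "\<dots> \<le> K * fock_norm x + K * fock_norm x"
        by (intro add_mono mult_left_mono K(1) fock_drop_letter(2)[OF x] order_refl)
      finally show "norm (T x (a # w) - T (\<lambda>u. x (a # u)) w) \<le> (2 * K) * fock_norm x"
        by simp
    next
      fix j and x :: "'n list \<Rightarrow> 'e" assume x: "x \<in> level j E"
      show "T x (a # w) - T (\<lambda>u. x (a # u)) w = 0"
      proof (cases "length w < j")
        case True
        then show ?thesis using U x by (simp add: shift_invariant_iff)
      next
        \<comment> \<open>Both terms lie strictly below the diagonal: row
          \<open>length w + 1\<close> against column \<open>j\<close>, and row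
          \<open>length w\<close> against column \<open>j - 1\<close>. For \<open>j = 0\<close> the
          truncated subtraction would give the wrong column, but then the shortened vector is
          0.\<close>
        case False
        have "T x (a # w) = 0"
          by (rule upper_triangularD[OF conjunct1[OF U] x]) (use False in simp)
        moreover have "T (\<lambda>u. x (a # u)) w = 0"
        proof (cases "j = 0")
          case True
          then show ?thesis using level_drop_letter(1)[OF x] bounded_ops_zero[OF T] by simp
        next
          case j: False
          show ?thesis
            by (rule upper_triangularD[OF conjunct1[OF U] level_drop_letter(2)[OF x]])
              (use False j in auto)
        qed
        ultimately show ?thesis by simp
      qed
    qed
    then show "T x (a # w) = T (\<lambda>u. x (a # u)) w" by simp
  qed
qed

lemma schur_class_iff:
  assumes "0 \<in> E"
  shows "T \<in> schur_class E F \<longleftrightarrow> T \<in> bounded_ops E F \<and>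
    (\<forall>x\<in>fock E. fock_norm (T x) \<le> fock_norm x) \<and> intertwining E T"
  using intertwining_iff[OF _ assms] by (auto simp: schur_class_def)

section \<open>Operators determined by their first row\<close>

lemma first_row_iff:
  assumes "x \<in> level j E"
  shows "entry T 0 j x = vacuum d \<longleftrightarrow> T x [] = d"
  by (auto simp: entry_level[OF assms] level_proj_def vacuum_def fun_eq_iff)

text \<open>\<open>Phi\<close> is a \<open>THE\<close>, so a competitor \<open>T'\<close> has to be
  excluded. Density identifies the coordinates at the empty word, and intertwining reduces any other
  word to the empty one by removing letters.\<close>

lemma Phi_eqI:
  fixes T :: "('n::finite list \<Rightarrow> 'e::complex_hilbert) \<Rightarrow> ('n list \<Rightarrow> 'f::complex_hilbert)"
  assumes T: "T \<in> bounded_ops E F" and E: "0 \<in> E" and I: "intertwining E T"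
    and r: "\<And>j x. x \<in> level j E \<Longrightarrow> T x [] = r j x"
  shows "Phi E F r = T"
  unfolding Phi_def
proof (rule the_equality)
  show "T \<in> bounded_ops E F \<and> upper_triangular E T \<and> shift_invariant E T \<and>
    (\<forall>j. \<forall>x\<in>level j E. entry T 0 j x = vacuum (r j x))"
    using T I r intertwining_iff[OF T E] by (simp add: first_row_iff)
next
  fix T' assume T': "T' \<in> bounded_ops E F \<and> upper_triangular E T' \<and> shift_invariant E T' \<and>
    (\<forall>j. \<forall>x\<in>level j E. entry T' 0 j x = vacuum (r j x))"
  then have B': "T' \<in> bounded_ops E F" and I': "intertwining E T'"
    and r': "\<And>j x. x \<in> level j E \<Longrightarrow> T' x [] = r j x"
    using intertwining_iff[OF _ E] by (auto simp: first_row_iff)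
  obtain K where K: "0 \<le> K" "\<And>x w. x \<in> fock E \<Longrightarrow> norm (T x w) \<le> K * fock_norm x"
    using bounded_ops_bound[OF T] by blast
  obtain K' where K': "0 \<le> K'" "\<And>x w. x \<in> fock E \<Longrightarrow> norm (T' x w) \<le> K' * fock_norm x"
    using bounded_ops_bound[OF B'] by blast
  have row: "T' x [] = T x []" if "x \<in> fock E" for x :: "'n list \<Rightarrow> 'e"
  proof -
    have "T' x [] - T x [] = 0"
    proof (rule fock_density[OF E _ _ _ that])
      fix x y :: "'n list \<Rightarrow> 'e" assume "x \<in> fock E" "y \<in> fock E"
      then show "T' (x + y) [] - T (x + y) [] = (T' x [] - T x []) + (T' y [] - T y [])"
        using bounded_opsD(3)[OF T] bounded_opsD(3)[OF B'] by simp
    next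
      fix x :: "'n list \<Rightarrow> 'e" assume x: "x \<in> fock E"
      show "norm (T' x [] - T x []) \<le> (K' + K) * fock_norm x"
        using norm_triangle_ineq4[of "T' x []" "T x []"] K(2)[OF x, of "[]"] K'(2)[OF x, of "[]"]
        by (simp add: distrib_right)
    qed (simp add: r r')
    then show ?thesis by simp
  qed
  have "T' x w = T x w" if "x \<in> fock E" for x :: "'n list \<Rightarrow> 'e" and w
    using that
    by (induction w arbitrary: x)
      (simp_all add: row intertwiningD[OF I] intertwiningD[OF I'] fock_drop_letter)
  then show "T' = T"
    using bounded_opsD(2)[OF T] bounded_opsD(2)[OF B'] by (metis ext)
qed

text \<open>The coefficient spaces stay general because each defect space may turn out to be
  \<open>{0}\<close> or all of \<open>UNIV\<close>, and both occur below.\<close>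

lemma Phi_row0_mult:
  fixes k :: complex
  assumes E: "0 \<in> E" "\<And>z v. z \<in> E \<Longrightarrow> v \<in> E \<Longrightarrow> z + v \<in> E" "\<And>c z. z \<in> E \<Longrightarrow> c * z \<in> E"
    and EF: "\<And>z. z \<in> E \<Longrightarrow> k * z \<in> F"
  shows "Phi E F (row0 (\<lambda>z. k * z)) = (\<lambda>x :: 'n::finite list \<Rightarrow> complex.
    if x \<in> fock E then (\<lambda>w. k * x w) else 0)" (is "_ = ?M")
proof (rule Phi_eqI[OF _ E(1)])
  have "x + y \<in> fock E" if "x \<in> fock E" "y \<in> fock E" for x y :: "'n list \<Rightarrow> complex"
    using that fock_add(1)[of x y] E(2) by (simp add: fock_iff[of _ E])
  moreover have "(\<lambda>w. c * x w) \<in> fock E" if "x \<in> fock E" for x :: "'n list \<Rightarrow> complex" and c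
    using that fock_mult(1)[of x c] E(3) by (simp add: fock_iff[of _ E])
  moreover have "(\<lambda>w. k * x w) \<in> fock F" "fock_norm (\<lambda>w. k * x w) \<le> cmod k * fock_norm x"
    if "x \<in> fock E" for x :: "'n list \<Rightarrow> complex"
    using that fock_mult[of x k] EF by (simp_all add: fock_iff[of _ E] fock_iff[of _ F])
  ultimately show "?M \<in> bounded_ops E F"
    by (auto intro!: exI[of _ "cmod k"] simp: bounded_ops_def scaleC_complex_def fun_eq_iff algebra_simps)
  show "intertwining E ?M"
    by (auto simp: intertwining_def fock_drop_letter)
  show "?M x [] = row0 (\<lambda>z. k * z) j x" if "x \<in> level j E" for j x
    using level_in_fock[OF that] that by (auto simp: row0_def level_def)
qed

section \<open>The resolvent of a contraction\<close>

locale neumann =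
  fixes T :: "('n::finite list \<Rightarrow> complex) \<Rightarrow> ('n list \<Rightarrow> complex)" and k :: complex
  assumes T: "T \<in> bounded_ops UNIV UNIV"
    and contraction: "\<And>x. x \<in> fock UNIV \<Longrightarrow> fock_norm (T x) \<le> fock_norm x"
    and k: "cmod k < 1"
begin

lemmas T_fock = bounded_opsD(1)[OF T]
  and T_add = bounded_opsD(3)[OF T]
  and T_mult = bounded_opsD(4)[OF T, unfolded scaleC_complex_def]

lemma T_diff:
  assumes "x \<in> fock UNIV" "y \<in> fock UNIV"
  shows "T (\<lambda>w. x w - b * y w) = (\<lambda>w. T x w - b * T y w)"
proof -
  have "(\<lambda>w. x w - b * y w) = x + (\<lambda>w. - b * y w)" by auto
  then have "T (\<lambda>w. x w - b * y w) = T x + T (\<lambda>w. - b * y w)"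
    using T_add[OF assms(1) fock_mult(1)[OF assms(2)]] by metis
  also have "\<dots> = (\<lambda>w. T x w - b * T y w)"
    unfolding T_mult[OF assms(2)] by auto
  finally show ?thesis .
qed

lemma pow:
  assumes "x \<in> fock UNIV"
  shows pow_fock: "(T ^^ n) x \<in> fock UNIV" and pow_norm: "fock_norm ((T ^^ n) x) \<le> fock_norm x"
proof (induction n)
  case (Suc n)
  case 1 show ?case using Suc T_fock by simp
  case 2 show ?case using Suc contraction[of "(T ^^ n) x"] by simp
qed (use assms in auto)

lemma pow_add:
  "x \<in> fock UNIV \<Longrightarrow> y \<in> fock UNIV \<Longrightarrow> (T ^^ n) (x + y) = (T ^^ n) x + (T ^^ n) y"
  by (induction n) (simp_all add: T_add pow_fock)

lemma pow_mult:
  "x \<in> fock UNIV \<Longrightarrow> (T ^^ n) (\<lambda>w. b * x w) = (\<lambda>w. b * (T ^^ n) x w)"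
  by (induction n) (simp_all add: T_mult pow_fock)

text \<open>The Neumann series of (I - k T)^-1, summed separately at each word.\<close>

definition resolvent :: "('n list \<Rightarrow> complex) \<Rightarrow> ('n list \<Rightarrow> complex)"
  where "resolvent x = (\<lambda>w. \<Sum>n. k ^ n * (T ^^ n) x w)"

lemma resolvent_summable:
  assumes "x \<in> fock UNIV"
  shows "summable (\<lambda>n. k ^ n * (T ^^ n) x w)"
proof (rule summable_comparison_test')
  show "summable (\<lambda>n. cmod k ^ n * fock_norm x)"
    using k by (intro summable_mult2 summable_geometric) simp
  show "norm (k ^ n * (T ^^ n) x w) \<le> cmod k ^ n * fock_norm x" for n
    using order_trans[OF norm_le_fock_norm[OF pow_fock[OF assms]] pow_norm[OF assms], of n w]
    by (simp add: norm_mult norm_power mult_left_mono)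
qed

text \<open>On a finite set \<open>F\<close> of words the partial sums obey Minkowski's inequality
  with a geometric majorant, and the limit involves only finitely many coordinates. The bound does
  not depend on \<open>F\<close>, so it holds for the full norm.\<close>

lemma resolvent_bound:
  assumes x: "x \<in> fock UNIV"
  shows resolvent_fock: "resolvent x \<in> fock UNIV"
    and resolvent_norm: "fock_norm (resolvent x) \<le> fock_norm x / (1 - cmod k)"
proof -
  have b: "L2_set (\<lambda>w. norm (resolvent x w)) F \<le> fock_norm x / (1 - cmod k)" if F: "finite F" for F
  proof -
    have "(\<lambda>m. \<Sum>n<m. k ^ n * (T ^^ n) x w) \<longlonglongrightarrow> resolvent x w" for w
      unfolding resolvent_def by (rule summable_LIMSEQ[OF resolvent_summable[OF x]])
    then have lim: "(\<lambda>m. L2_set (\<lambda>w. norm (\<Sum>n<m. k ^ n * (T ^^ n) x w)) F)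
        \<longlonglongrightarrow> L2_set (\<lambda>w. norm (resolvent x w)) F"
      unfolding L2_set_def by (intro tendsto_intros)
    have part: "L2_set (\<lambda>w. norm (\<Sum>n<m. k ^ n * (T ^^ n) x w)) F
        \<le> (\<Sum>n<m. cmod k ^ n * fock_norm x)" for m
    proof (induction m)
      case (Suc m)
      have "L2_set (\<lambda>w. norm (\<Sum>n<Suc m. k ^ n * (T ^^ n) x w)) F
          \<le> L2_set (\<lambda>w. norm (\<Sum>n<m. k ^ n * (T ^^ n) x w) + norm (k ^ m * (T ^^ m) x w)) F"
        by (rule L2_set_mono) (auto intro: norm_triangle_ineq)
      also have "\<dots> \<le> L2_set (\<lambda>w. norm (\<Sum>n<m. k ^ n * (T ^^ n) x w)) F
          + L2_set (\<lambda>w. norm (k ^ m * (T ^^ m) x w)) F"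
        by (rule L2_set_triangle_ineq)
      also have "L2_set (\<lambda>w. norm (k ^ m * (T ^^ m) x w)) F
          = cmod k ^ m * L2_set (\<lambda>w. norm ((T ^^ m) x w)) F"
        by (simp add: norm_mult norm_power L2_set_right_distrib)
      also have "\<dots> \<le> cmod k ^ m * fock_norm x"
        using order_trans[OF L2_set_le_fock_norm[OF pow_fock[OF x] F] pow_norm[OF x]]
        by (simp add: mult_left_mono)
      finally show ?case using Suc by simp
    qed (simp add: L2_set_def)
    also have "(\<Sum>n<m. cmod k ^ n * fock_norm x) \<le> fock_norm x / (1 - cmod k)" for m
    proof -
      have "(\<Sum>n<m. cmod k ^ n) \<le> (\<Sum>n. cmod k ^ n)"
        using k by (intro sum_le_suminf summable_geometric) auto
      also have "\<dots> = 1 / (1 - cmod k)"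
        using k by (intro suminf_geometric) simp
      finally have "(\<Sum>n<m. cmod k ^ n) * fock_norm x \<le> 1 / (1 - cmod k) * fock_norm x"
        by (rule mult_right_mono) simp
      then show ?thesis by (simp add: sum_distrib_right)
    qed
    finally show ?thesis
      by (intro LIMSEQ_le_const2[OF lim]) auto
  qed
  show "resolvent x \<in> fock UNIV" "fock_norm (resolvent x) \<le> fock_norm x / (1 - cmod k)"
    using fockI[of "resolvent x" UNIV, OF UNIV_I b] by auto
qed

lemma resolvent_add:
  "x \<in> fock UNIV \<Longrightarrow> y \<in> fock UNIV \<Longrightarrow> resolvent (x + y) = resolvent x + resolvent y"
  by (auto simp: resolvent_def pow_add distrib_left suminf_add[OF resolvent_summable resolvent_summable])

lemma resolvent_mult:
  "x \<in> fock UNIV \<Longrightarrow> resolvent (\<lambda>w. b * x w) = (\<lambda>w. b * resolvent x w)"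
  by (auto simp: resolvent_def pow_mult mult.left_commute[of _ b] suminf_mult[OF resolvent_summable])

text \<open>The index shift leaves \<open>T\<close> inside the series, where it acts on the
  argument. Pulling \<open>T\<close> out of the pointwise sum is a separate matter, settled by
  \<open>resolvent_commute\<close>.\<close>

lemma resolvent_unfold:
  assumes "x \<in> fock UNIV"
  shows "resolvent x = (\<lambda>w. x w + k * resolvent (T x) w)"
proof
  fix w
  have "resolvent x w = x w + (\<Sum>n. k ^ Suc n * (T ^^ Suc n) x w)"
    using suminf_split_head[OF resolvent_summable[OF assms, of w]] by (simp add: resolvent_def)
  also have "(\<Sum>n. k ^ Suc n * (T ^^ Suc n) x w) = k * resolvent (T x) w"
    unfolding resolvent_def
    by (subst suminf_mult[OF resolvent_summable[OF T_fock[OF assms]], symmetric])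
      (simp add: funpow_swap1 mult.assoc)
  finally show "resolvent x w = x w + k * resolvent (T x) w" .
qed

text \<open>
  By \<open>resolvent_unfold\<close>, the commutator \<open>G\<close> of \<open>T\<close> with the resolvent satisfies
  \<open>G x = k G (T x)\<close>, so it vanishes since \<open>k ^ n\<close> tends to \<open>0\<close>.
\<close>

lemma resolvent_commute:
  assumes x: "x \<in> fock UNIV"
  shows "T (resolvent x) = resolvent (T x)"
proof
  fix w
  define M where "M = 1 / (1 - cmod k)"
  have norm_resolvent: "fock_norm (resolvent x) \<le> M * fock_norm x" if "x \<in> fock UNIV" for x
    using resolvent_norm[OF that] by (simp add: M_def)
  have M: "0 \<le> M" using k by (simp add: M_def)
  \<comment> \<open>\<open>2 * M\<close> comes from the case \<open>n = 0\<close>: each of the two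
    terms is at most \<open>M * fock_norm x\<close>.\<close>
  have b: "cmod (T (resolvent x) w - resolvent (T x) w) \<le> cmod k ^ n * (2 * M * fock_norm x)"
    if "x \<in> fock UNIV" for x n
    using that
  proof (induction n arbitrary: x)
    case 0
    have "cmod (T (resolvent x) w) \<le> fock_norm (resolvent x)"
      using norm_le_fock_norm[OF T_fock[OF resolvent_fock[OF 0]], of w]
        contraction[OF resolvent_fock[OF 0]] by simp
    moreover have "cmod (resolvent (T x) w) \<le> M * fock_norm x"
      using norm_le_fock_norm[OF resolvent_fock[OF T_fock[OF 0]], of w]
        norm_resolvent[OF T_fock[OF 0]] mult_left_mono[OF contraction[OF 0] M] by linarith
    ultimately show ?case
      using norm_triangle_ineq4[of "T (resolvent x) w" "resolvent (T x) w"] norm_resolvent[OF 0]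
      by simp
  next
    case (Suc n)
    note Tx = T_fock[OF Suc.prems]
    have "resolvent x = x + (\<lambda>w. k * resolvent (T x) w)"
      by (subst resolvent_unfold[OF Suc.prems]) auto
    then have "T (resolvent x) = T x + (\<lambda>w. k * T (resolvent (T x)) w)"
      using T_add[OF Suc.prems fock_mult(1)[OF resolvent_fock[OF Tx]]]
        T_mult[OF resolvent_fock[OF Tx]] by metis
    moreover have "resolvent (T x) w = T x w + k * resolvent (T (T x)) w"
      by (subst resolvent_unfold[OF Tx]) simp
    ultimately have "T (resolvent x) w - resolvent (T x) w
        = k * (T (resolvent (T x)) w - resolvent (T (T x)) w)"
      by (simp add: algebra_simps)
    then have "cmod (T (resolvent x) w - resolvent (T x) w)
        = cmod k * cmod (T (resolvent (T x)) w - resolvent (T (T x)) w)"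
      by (simp add: norm_mult)
    also have "\<dots> \<le> cmod k * (cmod k ^ n * (2 * M * fock_norm (T x)))"
      by (intro mult_left_mono Suc.IH Tx) simp
    also have "\<dots> \<le> cmod k * (cmod k ^ n * (2 * M * fock_norm x))"
      by (intro mult_left_mono contraction Suc.prems) (use M in auto)
    finally show ?case by (simp add: mult.assoc)
  qed
  have "(\<lambda>n. cmod k ^ n * (2 * M * fock_norm x)) \<longlonglongrightarrow> 0 * (2 * M * fock_norm x)"
    using k by (intro tendsto_intros LIMSEQ_power_zero) simp
  then have "cmod (T (resolvent x) w - resolvent (T x) w) \<le> 0 * (2 * M * fock_norm x)"
    by (rule LIMSEQ_le_const) (use b[OF x] in auto)
  then show "T (resolvent x) w = resolvent (T x) w" by simp
qed

lemma resolvent_left: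
  assumes "x \<in> fock UNIV"
  shows "resolvent (\<lambda>w. x w - k * T x w) = x"
proof -
  note Tx = T_fock[OF assms]
  have "(\<lambda>w. x w - k * T x w) = x + (\<lambda>w. - k * T x w)" by auto
  then have "resolvent (\<lambda>w. x w - k * T x w) = resolvent x + (\<lambda>w. - k * resolvent (T x) w)"
    using resolvent_add[OF assms fock_mult(1)[OF Tx]] resolvent_mult[OF Tx] by metis
  then show ?thesis using resolvent_unfold[OF assms] by auto
qed

lemma resolvent_right:
  assumes "x \<in> fock UNIV"
  shows "resolvent x w - k * T (resolvent x) w = x w"
  using fun_cong[OF resolvent_unfold[OF assms], of w] resolvent_commute[OF assms] by simp

text \<open>Each power of \<open>T\<close> intertwines, by induction, and the series is evaluated at
  one word at a time, so the identity passes to the sum termwise.\<close>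

lemma resolvent_intertwining:
  assumes "intertwining UNIV T"
  shows "intertwining UNIV resolvent"
proof -
  have "(T ^^ n) x (a # w) = (T ^^ n) (\<lambda>u. x (a # u)) w" if "x \<in> fock UNIV" for n x a w
    using that
  proof (induction n arbitrary: x w)
    case (Suc n)
    have "(T ^^ Suc n) x (a # w) = T (\<lambda>u. (T ^^ n) x (a # u)) w"
      using intertwiningD[OF assms pow_fock[OF Suc.prems]] by simp
    also have "(\<lambda>u. (T ^^ n) x (a # u)) = (T ^^ n) (\<lambda>u. x (a # u))"
      using Suc.IH[OF Suc.prems] by blast
    finally show ?case by simp
  qed simp
  then show ?thesis by (simp add: intertwining_def resolvent_def)
qed

end


section \<open>The adjoint of the translation operator\<close>

definition translation_adj ::
    "('n::finite list \<Rightarrow> 'e::complex_hilbert ^ 'n) \<Rightarrow> 'n list \<Rightarrow> 'e"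
  where "translation_adj y = (\<lambda>w. if w = [] then 0 else y (butlast w) $ last w)"

lemma norm_vec_sq: "(norm (v :: 'e::real_normed_vector ^ 'n))\<^sup>2 = (\<Sum>i\<in>UNIV. (norm (v $ i))\<^sup>2)"
  by (simp add: norm_vec_def L2_set_def sum_nonneg)

lemma sum_snoc:
  fixes g :: "'n::finite list \<Rightarrow> real"
  shows "(\<Sum>w\<in>F. \<Sum>i\<in>UNIV. g (w @ [i])) = sum g ((\<lambda>(w, i). w @ [i]) ` (F \<times> UNIV))"
  by (subst sum.reindex) (auto simp: inj_on_def sum.cartesian_product intro!: sum.cong)

lemma translation_fock:
  fixes x :: "'n::finite list \<Rightarrow> 'e::complex_hilbert"
  assumes x: "x \<in> fock UNIV"
  shows "translation UNIV x \<in> fock UNIV"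
proof (rule fockI)
  fix F :: "'n list set" assume F: "finite F"
  have "L2_set (\<lambda>w. norm (translation UNIV x w)) F
      = L2_set (\<lambda>w. norm (x w)) ((\<lambda>(w, i). w @ [i]) ` (F \<times> UNIV))"
    by (simp add: L2_set_def translation_def x norm_vec_sq
        sum_snoc[where g = "\<lambda>w. (norm (x w))\<^sup>2"])
  also have "\<dots> \<le> fock_norm x"
    by (rule L2_set_le_fock_norm[OF x]) (use F in auto)
  finally show "L2_set (\<lambda>w. norm (translation UNIV x w)) F \<le> fock_norm x" .
qed simp

lemma translation_adj_bound:
  fixes y :: "'n::finite list \<Rightarrow> 'e::complex_hilbert ^ 'n"
  assumes y: "y \<in> fock UNIV"
  shows translation_adj_fock: "translation_adj y \<in> fock UNIV"
    and translation_adj_norm: "fock_norm (translation_adj y) \<le> fock_norm y"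
proof -
  have b: "L2_set (\<lambda>w. norm (translation_adj y w)) F \<le> fock_norm y" if F: "finite F" for F
  proof -
    let ?g = "\<lambda>w. (norm (translation_adj y w))\<^sup>2"
    have "sum ?g F = sum ?g (F - {[]})"
      using F by (intro sum.mono_neutral_right) (auto simp: translation_adj_def)
    \<comment> \<open>\<open>F\<close> is enlarged to all one-letter extensions of its shortened
      words; each block of siblings then adds up to the squared norm of one vector
      \<open>y w\<close>.\<close>
    also have "\<dots> \<le> sum ?g ((\<lambda>(w, i). w @ [i]) ` (butlast ` F \<times> UNIV))"
    proof (rule sum_mono2)
      show "F - {[]} \<subseteq> (\<lambda>(w, i). w @ [i]) ` (butlast ` F \<times> UNIV)"
      proof
        fix w assume w: "w \<in> F - {[]}"
        then have "w = (\<lambda>(w, i). w @ [i]) (butlast w, last w)" by simp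
        then show "w \<in> (\<lambda>(w, i). w @ [i]) ` (butlast ` F \<times> UNIV)" using w by blast
      qed
    qed (use F in auto)
    also have "\<dots> = (\<Sum>w\<in>butlast ` F. (norm (y w))\<^sup>2)"
      unfolding sum_snoc[symmetric] by (simp add: translation_adj_def norm_vec_sq)
    finally have "L2_set (\<lambda>w. norm (translation_adj y w)) F
        \<le> L2_set (\<lambda>w. norm (y w)) (butlast ` F)"
      by (simp add: L2_set_def)
    also have "\<dots> \<le> fock_norm y" by (rule L2_set_le_fock_norm[OF y]) (use F in simp)
    finally show ?thesis .
  qed
  show "translation_adj y \<in> fock UNIV" "fock_norm (translation_adj y) \<le> fock_norm y"
    using fockI[of "translation_adj y" UNIV, OF UNIV_I b] by auto
qed

lemma translation_translation_adj:
  "y \<in> fock UNIV \<Longrightarrow> translation UNIV (translation_adj y) = y"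
  by (simp add: translation_def translation_adj_fock) (simp add: translation_adj_def vec_eq_iff)

lemma translation_adj_translation:
  fixes x :: "'n::finite list \<Rightarrow> 'e::complex_hilbert"
  assumes "x \<in> fock UNIV"
  shows "translation_adj (translation UNIV x) + vacuum (x []) = x"
  using assms by (auto simp: translation_def translation_adj_def vacuum_def fun_eq_iff)

lemma translation_scaleC:
  "x \<in> fock UNIV \<Longrightarrow> translation UNIV (\<lambda>w. c *\<^sub>C x w) = (\<lambda>w. c *\<^sub>C translation UNIV x w)"
  by (auto simp: translation_def fock_scaleC scaleC_vec_def)

lemma translation_adj_add: "translation_adj (x + y) = translation_adj x + translation_adj y"
  by (auto simp: translation_adj_def)

lemma translation_adj_scaleC:
  "translation_adj (\<lambda>w. c *\<^sub>C y w) = (\<lambda>w. c *\<^sub>C translation_adj y w)"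
  using scaleC_add_right[of c 0 0] by (auto simp: translation_adj_def scaleC_vec_def)

text \<open>Removing the first letter and splitting off the last one commute, except at the
  one-letter word \<open>[a]\<close>, where they are the same letter. This produces the vacuum
  term.\<close>

lemma translation_adj_drop_letter:
  "(\<lambda>u. translation_adj y (a # u)) = translation_adj (\<lambda>u. y (a # u)) + vacuum (y [] $ a)"
  by (auto simp: translation_adj_def vacuum_def fun_eq_iff)

lemma vacuum_level: "0 \<in> E \<Longrightarrow> d \<in> E \<Longrightarrow> vacuum d \<in> level 0 E"
  by (auto simp: level_def vacuum_def)


section \<open>Defect operators of scalars\<close>

lemma cadjoint_mult: "cadjoint (\<lambda>z. c * z) = (\<lambda>z. cnj c * z)"
  unfolding cadjoint_def
proof (rule the_equality)
  show "\<forall>x y. cinner (c * x) y = cinner x (cnj c * y)"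
    by (simp add: cinner_complex_def)
next
  fix B assume "\<forall>x y. cinner (c * x) y = cinner x (B y)"
  then have "c * cnj y = cnj (B y)" for y
    by (metis cinner_complex_def mult.commute mult.right_neutral mult_1)
  then show "B = (\<lambda>z. cnj c * z)"
    by (metis complex_cnj_cnj complex_cnj_mult)
qed

text \<open>\<open>defect_op\<close> is a \<open>THE\<close>, so uniqueness matters too: a complex
  linear \<open>R\<close> is multiplication by \<open>R 1\<close>, positivity makes
  \<open>R 1\<close> a nonnegative real, and its square is prescribed.\<close>

lemma defect_op_mult:
  assumes c: "cmod c \<le> 1"
  shows "defect_op (\<lambda>z. c * z) = (\<lambda>z. complex_of_real (sqrt (1 - (cmod c)\<^sup>2)) * z)"
  unfolding defect_op_def cadjoint_mult
proof (rule the_equality)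
  define d where "d = sqrt (1 - (cmod c)\<^sup>2)"
  have d: "0 \<le> d" "d\<^sup>2 = 1 - (cmod c)\<^sup>2"
    using c by (simp_all add: d_def power_le_one)
  have dd: "complex_of_real d * complex_of_real d = 1 - cnj c * c"
  proof -
    have "complex_of_real d * complex_of_real d = complex_of_real (d\<^sup>2)"
      by (simp add: power2_eq_square)
    then show ?thesis unfolding d(2) by (simp add: complex_norm_square mult.commute del: of_real_power)
  qed
  have "positive_op (\<lambda>z. complex_of_real d * z)"
    unfolding positive_op_def
  proof (intro conjI allI)
    show "bounded_linear (\<lambda>z. complex_of_real d * z)" by (rule bounded_linear_mult_right)
    show "complex_of_real d * (b *\<^sub>C x) = b *\<^sub>C (complex_of_real d * x)" for b x
      by (simp add: scaleC_complex_def)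
    have "cinner (complex_of_real d * x) x = complex_of_real (d * (cmod x)\<^sup>2)" for x
      by (simp add: cinner_complex_def mult.assoc complex_norm_square[symmetric])
    then show "cinner (complex_of_real d * x) x \<in> \<real>\<^sub>\<ge>\<^sub>0" for x
      using d by (simp del: of_real_mult)
  qed
  then show "positive_op (\<lambda>z. complex_of_real (sqrt (1 - (cmod c)\<^sup>2)) * z) \<and>
    (\<forall>x. complex_of_real (sqrt (1 - (cmod c)\<^sup>2)) * (complex_of_real (sqrt (1 - (cmod c)\<^sup>2)) * x)
      = x - cnj c * (c * x))"
    using dd by (simp add: d_def[symmetric] mult.assoc[symmetric] left_diff_distrib)
  fix R assume R: "positive_op R \<and> (\<forall>x. R (R x) = x - cnj c * (c * x))"
  have lin: "R z = z * R 1" for z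
    using R unfolding positive_op_def scaleC_complex_def by (metis mult.right_neutral)
  have "cinner (R 1) 1 \<in> \<real>\<^sub>\<ge>\<^sub>0" using R by (simp add: positive_op_def)
  then obtain r where r: "0 \<le> r" "R 1 = complex_of_real r"
    by (auto simp: cinner_complex_def elim: nonneg_Reals_cases)
  have "R (R 1) = 1 - cnj c * c" using R by simp
  then have "complex_of_real r * complex_of_real r = complex_of_real d * complex_of_real d"
    using lin[of "R 1"] r(2) dd by simp
  then have "r * r = d * d" by (metis of_real_eq_iff of_real_mult)
  then have "r = d" using r(1) d(1) by (simp add: power2_eq_iff_nonneg power2_eq_square[symmetric])
  then show "R = (\<lambda>z. complex_of_real (sqrt (1 - (cmod c)\<^sup>2)) * z)"
    using lin r(2) unfolding d_def by (metis mult.commute)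
qed

text \<open>The source of the case distinction. As |conj(c)| = |c|, the defect spaces of T_00 and of
  its adjoint vanish together.\<close>

lemma defect_space_mult:
  assumes c: "cmod c \<le> 1"
  shows "defect_space (\<lambda>z. c * z) = (if cmod c = 1 then {0} else UNIV)"
proof (cases "cmod c = 1")
  case True
  then show ?thesis by (simp add: defect_space_def defect_op_mult[OF c])
next
  case False
  then have "(cmod c)\<^sup>2 < 1" using c by (simp add: power_less_one_iff)
  then have "complex_of_real (sqrt (1 - (cmod c)\<^sup>2)) \<noteq> 0" by simp
  then have "surj (\<lambda>z. complex_of_real (sqrt (1 - (cmod c)\<^sup>2)) * z)"
    by (intro surjI[of _ "\<lambda>z. z / complex_of_real (sqrt (1 - (cmod c)\<^sup>2))"]) simp
  then show ?thesis using False by (simp add: defect_space_def defect_op_mult[OF c])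
qed

section \<open>The fractional linear transform\<close>

text \<open>The usual B' = B' A B = B, but with \<open>id_op E\<close> in place of the identity
  function; absorbing it uses that operators vanish off \<open>fock E\<close> and map
  \<open>fock E\<close> into itself.\<close>

lemma inverse_op_eq:
  assumes "inverse_ops E A B"
  shows "inverse_op E A = B"
  unfolding inverse_op_def
proof (rule the_equality)
  fix B' assume B': "inverse_ops E A B'"
  have B'_id: "B' \<circ> id_op E = B'"
    using B' bounded_opsD(2)[of B'] bounded_ops_zero[of B']
    by (auto simp: inverse_ops_def id_op_def fun_eq_iff)
  have id_B: "id_op E \<circ> B = B"
  proof
    fix x
    have B: "B \<in> bounded_ops E E" using assms by (simp add: inverse_ops_def)
    show "(id_op E \<circ> B) x = B x"
      by (cases "x \<in> fock E") (simp_all add: bounded_opsD(1,2)[OF B] id_op_def)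
  qed
  have "B' = B' \<circ> (A \<circ> B)" using assms B'_id by (simp add: inverse_ops_def)
  also have "\<dots> = (B' \<circ> A) \<circ> B" by (simp add: o_assoc)
  also have "\<dots> = B" using B' id_B by (simp add: inverse_ops_def)
  finally show "B' = B" .
qed (fact assms)

definition scalar_op :: "complex \<Rightarrow> ('n::finite list \<Rightarrow> complex) \<Rightarrow> 'n list \<Rightarrow> complex"
  where "scalar_op k x = (if x \<in> fock UNIV then (\<lambda>w. k * x w) else 0)"

lemma Phi_row0_scalar: "Phi UNIV UNIV (row0 (\<lambda>z. k * z)) = scalar_op k"
  by (subst Phi_row0_mult) (auto simp: scalar_op_def fun_eq_iff)

lemma entry00_scalar:
  fixes T :: "('n::finite list \<Rightarrow> complex) \<Rightarrow> ('n list \<Rightarrow> complex)"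
  assumes "T \<in> bounded_ops UNIV UNIV"
  shows "entry00 T = (\<lambda>d. T (vacuum 1) [] * d)"
proof
  fix d :: complex
  have v: "(vacuum d :: 'n list \<Rightarrow> complex) \<in> level 0 UNIV" for d
    by (rule vacuum_level) auto
  have "(vacuum d :: 'n list \<Rightarrow> complex) = (\<lambda>w. d *\<^sub>C vacuum 1 w)"
    by (auto simp: vacuum_def scaleC_complex_def)
  then have "T (vacuum d) = (\<lambda>w. d * T (vacuum 1) w)"
    using bounded_opsD(4)[OF assms level_in_fock[OF v]] by (simp add: scaleC_complex_def)
  then show "entry00 T d = T (vacuum 1) [] * d"
    by (simp add: entry00_def entry_level[OF v] level_proj_def)
qed

lemma fock_norm_vacuum:
  "fock_norm (vacuum d :: 'n::finite list \<Rightarrow> 'e::complex_hilbert) \<le> norm d"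
proof (rule fockI(2)[where E = UNIV])
  fix F :: "'n list set" assume F: "finite F"
  have "(\<Sum>w\<in>F. (norm (vacuum d w))\<^sup>2) = (\<Sum>w\<in>F. if w = [] then (norm d)\<^sup>2 else 0)"
    by (rule sum.cong) (auto simp: vacuum_def)
  also have "\<dots> \<le> (norm d)\<^sup>2" using F by (simp add: sum.delta)
  finally show "L2_set (\<lambda>w. norm (vacuum d w)) F \<le> norm d"
    unfolding L2_set_def by (simp add: real_le_lsqrt sum_nonneg)
qed simp

lemma fock_norm_sq: "(fock_norm x)\<^sup>2 = (\<Sum>\<^sub>\<infinity>w. (norm (x w))\<^sup>2)"
  by (simp add: fock_norm_def infsum_nonneg)

lemma fock_summable: "x \<in> fock E \<Longrightarrow> (\<lambda>w. (norm (x w))\<^sup>2) summable_on UNIV"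
  by (simp add: fock_def)

lemma bounded_ops_UNIV_I:
  fixes T :: "('n::finite list \<Rightarrow> 'e::complex_hilbert) \<Rightarrow> ('n list \<Rightarrow> 'f::complex_hilbert)"
  assumes "\<And>x. x \<in> fock UNIV \<Longrightarrow> T x \<in> fock UNIV" "\<And>x. x \<notin> fock UNIV \<Longrightarrow> T x = 0"
    "\<And>x y. x \<in> fock UNIV \<Longrightarrow> y \<in> fock UNIV \<Longrightarrow> T (x + y) = T x + T y"
    "\<And>c x. x \<in> fock UNIV \<Longrightarrow> T (\<lambda>w. c *\<^sub>C x w) = (\<lambda>w. c *\<^sub>C T x w)"
    "\<And>x. x \<in> fock UNIV \<Longrightarrow> fock_norm (T x) \<le> K * fock_norm x"
  shows "T \<in> bounded_ops UNIV UNIV"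
  unfolding bounded_ops_def using assms by blast

section \<open>The Moebius transform of T for |c| < 1\<close>

locale schur_function =
  fixes T :: "('n::finite list \<Rightarrow> complex) \<Rightarrow> ('n list \<Rightarrow> complex)" and c :: complex
  assumes T_schur: "T \<in> schur_class UNIV UNIV"
    and T_vacuum: "T (vacuum 1) [] = c"
    and c: "cmod c < 1"
begin

lemma T_bounded: "T \<in> bounded_ops UNIV UNIV"
  and T_contraction: "x \<in> fock UNIV \<Longrightarrow> fock_norm (T x) \<le> fock_norm x"
  and T_intertwining: "intertwining UNIV T"
  using T_schur by (auto simp: schur_class_iff)

sublocale neumann T "cnj c"
  using T_bounded T_contraction c by unfold_locales simp_all

definition numer :: "('n list \<Rightarrow> complex) \<Rightarrow> 'n list \<Rightarrow> complex"
  where "numer x = (\<lambda>w. T x w - c * x w)"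

definition denom :: "('n list \<Rightarrow> complex) \<Rightarrow> 'n list \<Rightarrow> complex"
  where "denom x = (\<lambda>w. x w - cnj c * T x w)"

definition mobius :: "('n list \<Rightarrow> complex) \<Rightarrow> 'n list \<Rightarrow> complex"
  where "mobius x = resolvent (numer x)"

text \<open>Both defect operators, of T_00 and of its adjoint, are multiplication by this
  number.\<close>

definition defect :: complex
  where "defect = complex_of_real (sqrt (1 - (cmod c)\<^sup>2))"

lemma defect_sq: "defect * defect = 1 - c * cnj c"
  and defect_nonzero: "defect \<noteq> 0"
proof -
  have *: "(cmod c)\<^sup>2 < 1" using c by (simp add: power_less_one_iff)
  then have "defect * defect = complex_of_real (1 - (cmod c)\<^sup>2)"
    unfolding defect_def of_real_mult[symmetric] by simp
  then show "defect * defect = 1 - c * cnj c"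
    by (simp add: complex_norm_square[symmetric])
  show "defect \<noteq> 0" using * by (simp add: defect_def)
qed

lemma numer_fock: "x \<in> fock UNIV \<Longrightarrow> numer x \<in> fock UNIV"
  using fock_diff[OF T_fock fock_mult(1)[of x c]] by (simp add: numer_def fun_diff_def)

lemma denom_fock: "x \<in> fock UNIV \<Longrightarrow> denom x \<in> fock UNIV"
  using fock_diff[OF _ fock_mult(1)[OF T_fock, of x "cnj c"], of x]
  by (simp add: denom_def fun_diff_def)

lemma numer_add: "x \<in> fock UNIV \<Longrightarrow> y \<in> fock UNIV \<Longrightarrow> numer (x + y) = numer x + numer y"
  by (auto simp: numer_def T_add algebra_simps)

lemma numer_mult: "x \<in> fock UNIV \<Longrightarrow> numer (\<lambda>w. b * x w) = (\<lambda>w. b * numer x w)"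
  by (auto simp: numer_def T_mult algebra_simps)

lemma denom_add: "x \<in> fock UNIV \<Longrightarrow> y \<in> fock UNIV \<Longrightarrow> denom (x + y) = denom x + denom y"
  by (auto simp: denom_def T_add algebra_simps)

lemma denom_mult: "x \<in> fock UNIV \<Longrightarrow> denom (\<lambda>w. b * x w) = (\<lambda>w. b * denom x w)"
  by (auto simp: denom_def T_mult algebra_simps)

lemma numer_denom:
  assumes "x \<in> fock UNIV"
  shows "numer (denom x) = denom (numer x)"
proof -
  note Tx = T_fock[OF assms]
  have "T (denom x) = (\<lambda>w. T x w - cnj c * T (T x) w)"
    unfolding denom_def by (rule T_diff[OF assms Tx])
  moreover have "T (numer x) = (\<lambda>w. T (T x) w - c * T x w)"
    unfolding numer_def by (rule T_diff[OF Tx assms])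
  ultimately show ?thesis
    by (simp add: numer_def[of "denom x"] denom_def[of "numer x"])
      (simp add: numer_def denom_def algebra_simps)
qed

lemma numer_intertwining:
  "x \<in> fock UNIV \<Longrightarrow> numer x (a # w) = numer (\<lambda>u. x (a # u)) w"
  by (simp add: numer_def intertwiningD[OF T_intertwining])

text \<open>At the empty word the two terms cancel by the choice of \<open>c\<close>; at any other
  word intertwining turns the vacuum into 0. This is Z_00 = 0, which lets Z ignore the component
  that S drops.\<close>

lemma numer_vacuum: "numer (vacuum d) = 0"
proof
  fix w
  have v: "(vacuum b :: 'n list \<Rightarrow> complex) \<in> fock UNIV" for b
    by (rule level_in_fock[OF vacuum_level]) auto
  have eq: "(vacuum d :: 'n list \<Rightarrow> complex) = (\<lambda>w. d * vacuum 1 w)"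
    by (auto simp: vacuum_def)
  show "numer (vacuum d) w = 0 w"
  proof (cases w)
    case Nil
    then show ?thesis
      using T_mult[OF v, of d 1] T_vacuum unfolding eq by (simp add: numer_def vacuum_def)
  next
    case (Cons a u)
    have "(\<lambda>u. vacuum d (a # u)) = (0 :: 'n list \<Rightarrow> complex)" by (auto simp: vacuum_def)
    then show ?thesis
      using Cons intertwiningD[OF T_intertwining v[of d], of a u] bounded_ops_zero[OF T_bounded]
      by (simp add: numer_def vacuum_def)
  qed
qed

lemma numer_add_vacuum:
  "x \<in> fock UNIV \<Longrightarrow> numer (x + vacuum d) = numer x"
  using numer_add[OF _ level_in_fock[OF vacuum_level]] by (simp add: numer_vacuum)

lemma numer_translation:
  "x \<in> fock UNIV \<Longrightarrow> numer (translation_adj (translation UNIV x)) = numer x"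
  by (metis numer_add_vacuum translation_adj_fock translation_adj_translation translation_fock)

text \<open>
  Integrates \<open>|u - c\<^sup>* t|\<^sup>2 - |t - c u|\<^sup>2 = (1 - |c|\<^sup>2) (|u|\<^sup>2 - |t|\<^sup>2)\<close>.
\<close>

lemma fock_norm_numer_le:
  assumes x: "x \<in> fock UNIV"
  shows "fock_norm (numer x) \<le> fock_norm (denom x)"
proof -
  define b where "b = 1 - (cmod c)\<^sup>2"
  have b: "0 \<le> b" using c by (simp add: b_def power_le_one)
  have pt: "(cmod (t - c * u))\<^sup>2 + b * (cmod u)\<^sup>2 = (cmod (u - cnj c * t))\<^sup>2 + b * (cmod t)\<^sup>2" for t u
    by (simp add: b_def cmod_power2) (simp add: power2_eq_square algebra_simps)
  note s = fock_summable[OF x] fock_summable[OF T_fock[OF x]]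
    fock_summable[OF numer_fock[OF x]] fock_summable[OF denom_fock[OF x]]
  have "(fock_norm (numer x))\<^sup>2 + b * (fock_norm x)\<^sup>2
      = (\<Sum>\<^sub>\<infinity>w. (cmod (numer x w))\<^sup>2 + b * (cmod (x w))\<^sup>2)"
    unfolding fock_norm_sq
    by (simp add: infsum_add infsum_cmult_right' summable_on_cmult_right s)
  also have "\<dots> = (\<Sum>\<^sub>\<infinity>w. (cmod (denom x w))\<^sup>2 + b * (cmod (T x w))\<^sup>2)"
    by (simp add: numer_def denom_def pt)
  also have "\<dots> = (fock_norm (denom x))\<^sup>2 + b * (fock_norm (T x))\<^sup>2"
    unfolding fock_norm_sq
    by (simp add: infsum_add infsum_cmult_right' summable_on_cmult_right s)
  also have "\<dots> \<le> (fock_norm (denom x))\<^sup>2 + b * (fock_norm x)\<^sup>2"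
    using b T_contraction[OF x] by (intro add_left_mono mult_left_mono power_mono) auto
  finally show ?thesis by (simp add: power2_le_iff_abs_le)
qed

lemma resolvent_denom: "x \<in> fock UNIV \<Longrightarrow> resolvent (denom x) = x"
  unfolding denom_def by (rule resolvent_left)

lemma denom_resolvent: "x \<in> fock UNIV \<Longrightarrow> denom (resolvent x) = x"
  unfolding denom_def using resolvent_right by blast

lemma mobius_fock: "x \<in> fock UNIV \<Longrightarrow> mobius x \<in> fock UNIV"
  by (simp add: mobius_def resolvent_fock numer_fock)

text \<open>Numerator and denominator commute, hence so do numerator and resolvent. In this order
  \<open>fock_norm_numer_le\<close> can be applied to \<open>resolvent x\<close>, whose denominator
  is \<open>x\<close>, and gives contractivity.\<close>

lemma mobius_eq:
  assumes "x \<in> fock UNIV"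
  shows "mobius x = numer (resolvent x)"
  using numer_denom[OF resolvent_fock[OF assms]] denom_resolvent[OF assms]
    resolvent_denom[OF numer_fock[OF resolvent_fock[OF assms]]]
  by (simp add: mobius_def)

lemma mobius_contraction:
  assumes "x \<in> fock UNIV"
  shows "fock_norm (mobius x) \<le> fock_norm x"
  using fock_norm_numer_le[OF resolvent_fock[OF assms]]
  by (simp add: mobius_eq[OF assms] denom_resolvent[OF assms])

section \<open>The solution T_1 = Z S^*\<close>

definition T1 :: "('n list \<Rightarrow> complex ^ 'n) \<Rightarrow> 'n list \<Rightarrow> complex"
  where "T1 y = (if y \<in> fock UNIV then mobius (translation_adj y) else 0)"

lemma T1_translation:
  "x \<in> fock UNIV \<Longrightarrow> T1 (translation UNIV x) = mobius x"
  by (simp add: T1_def translation_fock mobius_def numer_translation)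

text \<open>Contractivity is inherited from both factors. For intertwining, the vacuum term of
  \<open>translation_adj_drop_letter\<close> is removed by \<open>numer\<close> before the
  resolvent, which does intertwine, is applied.\<close>

lemma T1_schur: "T1 \<in> schur_class UNIV UNIV"
proof -
  have norm: "fock_norm (T1 y) \<le> fock_norm y" if "y \<in> fock UNIV" for y
    using mobius_contraction[OF translation_adj_fock[OF that]] translation_adj_norm[OF that] that
    by (simp add: T1_def)
  have "T1 \<in> bounded_ops UNIV UNIV"
  proof (rule bounded_ops_UNIV_I[where K = 1])
    fix x y :: "'n list \<Rightarrow> complex ^ 'n" assume xy: "x \<in> fock UNIV" "y \<in> fock UNIV"
    then show "T1 (x + y) = T1 x + T1 y"
      by (simp add: T1_def fock_add mobius_def translation_adj_add numer_add translation_adj_fock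
          resolvent_add numer_fock)
  next
    fix b and x :: "'n list \<Rightarrow> complex ^ 'n" assume x: "x \<in> fock UNIV"
    then show "T1 (\<lambda>w. b *\<^sub>C x w) = (\<lambda>w. b *\<^sub>C T1 x w)"
      by (simp add: T1_def fock_scaleC mobius_def translation_adj_scaleC scaleC_complex_def
          numer_mult translation_adj_fock resolvent_mult numer_fock)
  qed (use norm in \<open>auto simp: T1_def mobius_fock translation_adj_fock\<close>)
  moreover have "T1 y (a # w) = T1 (\<lambda>u. y (a # u)) w" if y: "y \<in> fock UNIV" for y a w
  proof -
    have y': "(\<lambda>u. y (a # u)) \<in> fock UNIV" by (rule fock_drop_letter[OF y])
    have "T1 y (a # w) = resolvent (\<lambda>u. numer (translation_adj y) (a # u)) w"
      using intertwiningD[OF resolvent_intertwining[OF T_intertwining]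
          numer_fock[OF translation_adj_fock[OF y]]]
      by (simp add: T1_def y mobius_def)
    also have "(\<lambda>u. numer (translation_adj y) (a # u))
        = numer (translation_adj (\<lambda>u. y (a # u)) + vacuum (y [] $ a))"
      using numer_intertwining[OF translation_adj_fock[OF y]]
      by (auto simp: translation_adj_drop_letter)
    also have "\<dots> = numer (translation_adj (\<lambda>u. y (a # u)))"
      by (rule numer_add_vacuum[OF translation_adj_fock[OF y']])
    finally show ?thesis by (simp add: T1_def y' mobius_def)
  qed
  ultimately show ?thesis
    using norm by (simp add: schur_class_iff intertwining_def)
qed

section \<open>The realization formula: the operator I + conj(c) R S and its inverse\<close>

definition feedback ::
    "(('n list \<Rightarrow> complex ^ 'n) \<Rightarrow> 'n list \<Rightarrow> complex) \<Rightarrow>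
      ('n list \<Rightarrow> complex) \<Rightarrow> 'n list \<Rightarrow> complex"
  where "feedback R = id_op UNIV - (scalar_op (- cnj c) \<circ> R \<circ> translation UNIV)"

text \<open>This is d^-2 (I - conj(c) T), read off from \<open>feedback_T1\<close>.\<close>

definition feedback_inv :: "('n list \<Rightarrow> complex) \<Rightarrow> 'n list \<Rightarrow> complex"
  where "feedback_inv x = (if x \<in> fock UNIV then (\<lambda>w. denom x w / defect\<^sup>2) else 0)"

lemma feedback_eq:
  assumes R: "R \<in> bounded_ops UNIV UNIV" and x: "x \<in> fock UNIV"
  shows "feedback R x = (\<lambda>w. x w + cnj c * R (translation UNIV x) w)"
  using bounded_opsD(1)[OF R translation_fock[OF x]] x
  by (auto simp: feedback_def id_op_def scalar_op_def)

text \<open>Over the common denominator the terms with T cancel: (I - conj(c) T) + conj(c) (T - c) =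
  1 - |c|^2.\<close>

lemma feedback_T1:
  assumes x: "x \<in> fock UNIV"
  shows "feedback T1 x = (\<lambda>w. defect\<^sup>2 * resolvent x w)"
proof
  fix w
  have "feedback T1 x w = x w + cnj c * mobius x w"
    using feedback_eq[OF _ x, of T1] T1_schur by (simp add: schur_class_def T1_translation[OF x])
  also have "x w = denom (resolvent x) w"
    by (simp add: denom_resolvent[OF x])
  also have "denom (resolvent x) w + cnj c * mobius x w = defect\<^sup>2 * resolvent x w"
    by (simp add: mobius_eq[OF x] denom_def numer_def power2_eq_square defect_sq)
      (simp add: algebra_simps)
  finally show "feedback T1 x w = defect\<^sup>2 * resolvent x w" .
qed

lemma inverse_ops_feedback_T1: "inverse_ops UNIV (feedback T1) feedback_inv"
  unfolding inverse_ops_def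
proof (intro conjI)
  \<comment> \<open>Equality with \<open>id_op\<close> concerns all families, so the values off
    \<open>fock UNIV\<close> have to be checked as well.\<close>
  have out: "feedback T1 x = 0" if "x \<notin> fock UNIV" for x
  proof -
    have "T1 0 = 0" using bounded_ops_zero T1_schur by (auto simp: schur_class_def)
    then show ?thesis using that
      by (simp add: feedback_def id_op_def scalar_op_def translation_def fun_eq_iff)
  qed
  show "feedback T1 \<in> bounded_ops UNIV UNIV"
  proof (rule bounded_ops_UNIV_I[where K = "cmod (defect\<^sup>2) / (1 - cmod c)"])
    fix x :: "'n list \<Rightarrow> complex" assume x: "x \<in> fock UNIV"
    show "feedback T1 x \<in> fock UNIV"
      by (simp add: feedback_T1[OF x] fock_mult(1)[OF resolvent_fock[OF x]])
    show "fock_norm (feedback T1 x) \<le> cmod (defect\<^sup>2) / (1 - cmod c) * fock_norm x"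
      using order_trans[OF fock_mult(2)[OF resolvent_fock[OF x], of "defect\<^sup>2"]
          mult_left_mono[OF resolvent_norm[OF x], of "cmod (defect\<^sup>2)"]]
      by (simp add: feedback_T1[OF x])
    show "feedback T1 (\<lambda>w. b *\<^sub>C x w) = (\<lambda>w. b *\<^sub>C feedback T1 x w)" for b
      by (simp add: scaleC_complex_def feedback_T1 fock_mult x resolvent_mult mult.left_commute)
    fix y :: "'n list \<Rightarrow> complex" assume y: "y \<in> fock UNIV"
    show "feedback T1 (x + y) = feedback T1 x + feedback T1 y"
      by (auto simp: feedback_T1 fock_add x y resolvent_add distrib_left)
  qed (fact out)
  show "feedback_inv \<in> bounded_ops UNIV UNIV"
  \<comment> \<open>The factor 2 bounds the norm of I - conj(c) T, since |c| < 1 and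
    \<open>T\<close> is a contraction.\<close>
  proof (rule bounded_ops_UNIV_I[where K = "cmod (1 / defect\<^sup>2) * 2"])
    fix x :: "'n list \<Rightarrow> complex" assume x: "x \<in> fock UNIV"
    have eq: "feedback_inv x = (\<lambda>w. (1 / defect\<^sup>2) * denom x w)"
      by (simp add: feedback_inv_def x)
    show "feedback_inv x \<in> fock UNIV"
      unfolding eq by (rule fock_mult(1)[OF denom_fock[OF x]])
    have "denom x = x + (\<lambda>w. - cnj c * T x w)" by (auto simp: denom_def)
    then have "fock_norm (denom x) \<le> fock_norm x + fock_norm (\<lambda>w. - cnj c * T x w)"
      using fock_add(2)[OF x fock_mult(1)[OF T_fock[OF x]]] by metis
    also have "fock_norm (\<lambda>w. - cnj c * T x w) \<le> cmod (- cnj c) * fock_norm (T x)"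
      by (rule fock_mult(2)[OF T_fock[OF x]])
    also have "\<dots> \<le> 1 * fock_norm x"
      using c T_contraction[OF x] by (intro mult_mono) auto
    finally have "fock_norm (denom x) \<le> 2 * fock_norm x" by simp
    then show "fock_norm (feedback_inv x) \<le> cmod (1 / defect\<^sup>2) * 2 * fock_norm x"
      using order_trans[OF fock_mult(2)[OF denom_fock[OF x], of "1 / defect\<^sup>2"]
          mult_left_mono[of _ "2 * fock_norm x" "cmod (1 / defect\<^sup>2)"]]
      unfolding eq by simp
    show "feedback_inv (\<lambda>w. b *\<^sub>C x w) = (\<lambda>w. b *\<^sub>C feedback_inv x w)" for b
      by (simp add: scaleC_complex_def feedback_inv_def fock_mult x denom_mult)
    fix y :: "'n list \<Rightarrow> complex" assume y: "y \<in> fock UNIV"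
    show "feedback_inv (x + y) = feedback_inv x + feedback_inv y"
      by (auto simp: feedback_inv_def fock_add x y denom_add add_divide_distrib)
  qed (simp add: feedback_inv_def)
  show "feedback T1 \<circ> feedback_inv = id_op UNIV"
  proof
    fix x
    show "(feedback T1 \<circ> feedback_inv) x = id_op UNIV x"
    proof (cases "x \<in> fock UNIV")
      case x: True
      have "feedback_inv x = (\<lambda>w. (1 / defect\<^sup>2) * denom x w)"
        by (simp add: feedback_inv_def x)
      then show ?thesis
        using defect_nonzero x
        by (simp add: feedback_T1 fock_mult(1)[OF denom_fock[OF x], of "1 / defect\<^sup>2", simplified]
            resolvent_mult[OF denom_fock[OF x], of "1 / defect\<^sup>2", simplified] resolvent_denom id_op_def)
    next
      case False
      have "feedback T1 0 = (\<lambda>w. defect\<^sup>2 * resolvent 0 w)"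
        by (rule feedback_T1) (simp add: fock_zero)
      moreover have "resolvent 0 = 0"
        using resolvent_add[OF fock_zero(1) fock_zero(1)] by (metis UNIV_I add.right_neutral add_left_cancel)
      ultimately show ?thesis using False by (simp add: feedback_inv_def id_op_def fun_eq_iff)
    qed
  qed
  show "feedback_inv \<circ> feedback T1 = id_op UNIV"
  proof
    fix x
    show "(feedback_inv \<circ> feedback T1) x = id_op UNIV x"
    proof (cases "x \<in> fock UNIV")
      case x: True
      then show ?thesis
        using defect_nonzero
        by (simp add: feedback_inv_def feedback_T1[OF x] fock_mult(1)[OF resolvent_fock[OF x]]
            denom_mult[OF resolvent_fock[OF x]] denom_resolvent id_op_def)
    next
      case False
      then show ?thesis
        using bounded_ops_zero[OF T_bounded]
        by (auto simp: out feedback_inv_def denom_def id_op_def fock_zero fun_eq_iff)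
    qed
  qed
qed

definition realization ::
    "(('n list \<Rightarrow> complex ^ 'n) \<Rightarrow> 'n list \<Rightarrow> complex) \<Rightarrow>
      ('n list \<Rightarrow> complex) \<Rightarrow> 'n list \<Rightarrow> complex"
  where "realization R = scalar_op c + (scalar_op defect \<circ> R \<circ> translation UNIV \<circ>
    inverse_op UNIV (feedback R) \<circ> scalar_op defect)"

text \<open>The inverse followed by Z turns \<open>defect * x\<close> into (1/d) Z (I - conj(c) T) x
  = (1/d) (T - c) x; the outer factor d and the summand c then restore T.\<close>

lemma realization_T1: "T = realization T1"
proof
  fix x
  have inv: "inverse_op UNIV (feedback T1) = feedback_inv"
    by (rule inverse_op_eq[OF inverse_ops_feedback_T1])
  show "T x = realization T1 x"
  proof (cases "x \<in> fock UNIV")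
    case x: True
    note dx = denom_fock[OF x]
    have eq: "feedback_inv (scalar_op defect x) = (\<lambda>w. (1 / defect) * denom x w)"
      using defect_nonzero
      by (auto simp: feedback_inv_def scalar_op_def x fock_mult denom_mult power2_eq_square)
    have "mobius (\<lambda>w. (1 / defect) * denom x w) = (\<lambda>w. (1 / defect) * mobius (denom x) w)"
      unfolding mobius_def numer_mult[OF dx] by (rule resolvent_mult[OF numer_fock[OF dx]])
    also have "mobius (denom x) = numer x"
      by (simp add: mobius_def numer_denom[OF x] resolvent_denom[OF numer_fock[OF x]])
    finally have "T1 (translation UNIV (feedback_inv (scalar_op defect x)))
        = (\<lambda>w. (1 / defect) * numer x w)"
      unfolding eq T1_translation[OF fock_mult(1)[OF dx]] .
    then have "realization T1 x
        = scalar_op c x + scalar_op defect (\<lambda>w. (1 / defect) * numer x w)"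
      by (simp only: realization_def inv comp_apply plus_fun_apply)
    also have "\<dots> = T x"
      using defect_nonzero fock_mult(1)[OF numer_fock[OF x], of "1 / defect"]
      by (auto simp: scalar_op_def x numer_def)
    finally show ?thesis ..
  next
    case False
    have z: "0 \<in> fock UNIV" by (rule fock_zero) simp
    have "denom 0 = 0" using bounded_ops_zero[OF T_bounded] by (auto simp: denom_def)
    then have "feedback_inv 0 = 0" by (auto simp: feedback_inv_def)
    moreover have "translation UNIV (0 :: 'n list \<Rightarrow> complex) = 0"
      by (auto simp: translation_def vec_eq_iff)
    moreover have "T1 0 = 0"
      using bounded_ops_zero T1_schur by (auto simp: schur_class_def)
    ultimately have "realization T1 x = 0"
      using False by (auto simp: realization_def inv scalar_op_def)
    then show ?thesis using bounded_opsD(2)[OF T_bounded False] by simp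
  qed
qed

text \<open>The formula is evaluated at \<open>feedback R x\<close>, where the inverse cancels;
  invertibility is what gives \<open>inverse_op\<close> its meaning here. With z = R S x this leaves
  T (x + conj(c) z) = c (x + conj(c) z) + d^2 z, that is, \<open>denom z = numer x\<close>, which
  the resolvent solves for z.\<close>

lemma realization_unique:
  assumes R: "R \<in> bounded_ops UNIV UNIV" and inv: "invertible_op UNIV (feedback R)"
    and T: "T = realization R"
  shows "R = T1"
proof
  obtain V where V: "inverse_ops UNIV (feedback R) V"
    using inv by (auto simp: invertible_op_def)
  then have V_bounded: "V \<in> bounded_ops UNIV UNIV"
    and A_bounded: "feedback R \<in> bounded_ops UNIV UNIV" by (simp_all add: inverse_ops_def)
  have V_mult: "V (\<lambda>w. b * x w) = (\<lambda>w. b * V x w)" if "x \<in> fock UNIV" for b x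
    using bounded_opsD(4)[OF V_bounded that] by (simp add: scaleC_complex_def)
  have mobius: "R (translation UNIV x) = mobius x" if x: "x \<in> fock UNIV" for x
  proof -
    define z where "z = R (translation UNIV x)"
    have z: "z \<in> fock UNIV"
      unfolding z_def by (rule bounded_opsD(1)[OF R translation_fock[OF x]])
    note Ax = bounded_opsD(1)[OF A_bounded x]
    have A: "feedback R x = x + (\<lambda>w. cnj c * z w)"
      by (auto simp: feedback_eq[OF R x] z_def)
    have "V (feedback R x) = x"
      using V x by (auto simp: inverse_ops_def id_op_def fun_eq_iff)
    then have "V (scalar_op defect (feedback R x)) = (\<lambda>w. defect * x w)"
      by (simp add: scalar_op_def Ax V_mult)
    moreover have "R (translation UNIV (\<lambda>w. defect * x w)) = (\<lambda>w. defect * z w)"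
      using translation_scaleC[OF x, of defect] bounded_opsD(4)[OF R translation_fock[OF x], of defect]
      by (simp add: scaleC_complex_def z_def)
    ultimately have "realization R (feedback R x)
        = scalar_op c (feedback R x) + scalar_op defect (\<lambda>w. defect * z w)"
      by (simp only: realization_def inverse_op_eq[OF V] comp_apply plus_fun_apply)
    then have 1: "T (feedback R x) w = c * feedback R x w + defect * (defect * z w)" for w
      using T Ax fock_mult(1)[OF z, of defect] by (simp add: scalar_op_def)
    have "T (feedback R x) = T x + (\<lambda>w. cnj c * T z w)"
      unfolding A T_add[OF x fock_mult(1)[OF z]] T_mult[OF z] ..
    then have "T x w + cnj c * T z w = c * (x w + cnj c * z w) + (1 - c * cnj c) * z w" for w
      using 1[of w] A by (simp add: defect_sq[symmetric] mult.assoc)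
    then have "T x w + cnj c * T z w = c * x w + z w" for w
      by (simp add: algebra_simps)
    then have "denom z = numer x"
      by (auto simp: denom_def numer_def algebra_simps)
    then show ?thesis
      using resolvent_denom[OF z] by (simp add: mobius_def z_def)
  qed
  fix y
  show "R y = T1 y"
  proof (cases "y \<in> fock UNIV")
    case True
    then show ?thesis
      using mobius[OF translation_adj_fock[OF True]]
      by (simp add: translation_translation_adj T1_def)
  qed (use bounded_opsD(2)[OF R] in \<open>simp add: T1_def\<close>)
qed

end


section \<open>The extremal case\<close>

lemma schur_extremal:
  fixes T :: "('n::finite list \<Rightarrow> complex) \<Rightarrow> ('n list \<Rightarrow> complex)"
  assumes T: "T \<in> schur_class UNIV UNIV" and c: "T (vacuum 1) [] = c" "cmod c = 1"
  shows "T = scalar_op c"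
proof -
  have B: "T \<in> bounded_ops UNIV UNIV" and I: "intertwining UNIV T"
    and contr: "\<And>x. x \<in> fock UNIV \<Longrightarrow> fock_norm (T x) \<le> fock_norm x"
    using T by (auto simp: schur_class_iff)
  have v: "(vacuum b :: 'n list \<Rightarrow> complex) \<in> fock UNIV" for b
    by (rule level_in_fock[OF vacuum_level]) auto
  have Tv: "T (vacuum b) [] = c * b" for b
    using fun_cong[OF entry00_scalar[OF B], of b] c(1)
    by (simp add: entry00_def entry_level[OF vacuum_level[of UNIV]] level_proj_def)
  have zero: "T x [] = 0" if x: "x \<in> fock UNIV" and x0: "x [] = 0" for x
  proof (rule ccontr)
    define t where "t = T x []"
    assume "T x [] \<noteq> 0"
    then have t: "(cmod t)\<^sup>2 > 0" by (simp add: t_def)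
    have "(2 * r) * (cmod t)\<^sup>2 \<le> (fock_norm x)\<^sup>2" for r
    proof -
      \<comment> \<open>The phase is chosen so that \<open>c * b = r * t\<close>, parallel to
        \<open>t\<close>. The output at the empty word is then (1 + r) t while the input gains only
        r^2 |t|^2; the quadratic terms cancel and a term linear in \<open>r\<close> remains
        bounded.\<close>
      define b where "b = complex_of_real r * cnj c * t"
      have z: "x + vacuum b \<in> fock UNIV" by (rule fock_add[OF x v])
      have "T (x + vacuum b) [] = t + c * b"
        by (simp add: bounded_opsD(3)[OF B x v] Tv t_def)
      also have "\<dots> = (1 + complex_of_real r * (c * cnj c)) * t"
        by (simp add: b_def algebra_simps)
      also have "c * cnj c = 1" using c(2) by (simp add: complex_norm_square[symmetric])
      finally have "cmod (T (x + vacuum b) []) = cmod (complex_of_real (1 + r)) * cmod t"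
        by (simp only: norm_mult of_real_add of_real_1 mult_1_right)
      then have "(1 + r)\<^sup>2 * (cmod t)\<^sup>2 = (cmod (T (x + vacuum b) []))\<^sup>2"
        by (simp only: norm_of_real power_mult_distrib power2_abs)
      also have "\<dots> \<le> (fock_norm (x + vacuum b))\<^sup>2"
        using order_trans[OF norm_le_fock_norm[OF bounded_opsD(1)[OF B z]] contr[OF z]]
        by (simp add: power_mono)
      also have "\<dots> = (\<Sum>\<^sub>\<infinity>w. (cmod (x w))\<^sup>2 + (cmod (vacuum b w :: complex))\<^sup>2)"
        unfolding fock_norm_sq by (rule infsum_cong) (auto simp: vacuum_def x0)
      also have "\<dots> = (fock_norm x)\<^sup>2 + (fock_norm (vacuum b :: 'n list \<Rightarrow> complex))\<^sup>2"
        unfolding fock_norm_sq by (intro infsum_add fock_summable[OF x] fock_summable[OF v])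
      also have "\<dots> \<le> (fock_norm x)\<^sup>2 + (cmod b)\<^sup>2"
        by (simp add: power_mono fock_norm_vacuum)
      also have "(cmod b)\<^sup>2 = r\<^sup>2 * (cmod t)\<^sup>2"
        using c(2) by (simp add: b_def norm_mult power_mult_distrib)
      finally have "(1 + 2 * r) * (cmod t)\<^sup>2 \<le> (fock_norm x)\<^sup>2"
        by (simp add: power2_eq_square algebra_simps)
      then show ?thesis using t unfolding distrib_right by linarith
    qed
    \<comment> \<open>For this \<open>r\<close> the left side is
      \<open>(fock_norm x)\<^sup>2 + 1\<close>, above the bound.\<close>
    from this[of "((fock_norm x)\<^sup>2 + 1) / (2 * (cmod t)\<^sup>2)"] t show False
      by simp
  qed
  have row: "T x [] = c * x []" if x: "x \<in> fock UNIV" for x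
  proof -
    define y where "y = x - vacuum (x [])"
    have y: "y \<in> fock UNIV" unfolding y_def by (rule fock_diff[OF x v])
    have "T x = T (y + vacuum (x []))" by (simp add: y_def)
    then show ?thesis
      using zero[OF y] by (simp add: bounded_opsD(3)[OF B y v] Tv) (simp add: y_def vacuum_def)
  qed
  have "T x w = c * x w" if "x \<in> fock UNIV" for x w
    using that
    by (induction w arbitrary: x) (simp_all add: row intertwiningD[OF I] fock_drop_letter)
  then show ?thesis
    using bounded_opsD(2)[OF B] by (auto simp: scalar_op_def fun_eq_iff)
qed

lemma fock_zero_space: "fock {0} = {0}"
  by (auto simp: fock_def fun_eq_iff)

text \<open>A singleton also as a set of functions, because operators are extended by 0; this
  supplies existence and uniqueness of T_1 when |c| = 1.\<close>

lemma schur_class_zero_space: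
  "schur_class {0} {0} = {\<lambda>_ :: 'n::finite list \<Rightarrow> 'e::complex_hilbert. 0 :: 'n list \<Rightarrow> 'f::complex_hilbert}"
proof -
  have "T x = 0" if "T \<in> schur_class {0} {0}"
    for T :: "('n list \<Rightarrow> 'e) \<Rightarrow> ('n list \<Rightarrow> 'f)" and x
    using that bounded_opsD(1,2)[of T "{0}" "{0}" x]
    by (cases "x \<in> fock {0}") (auto simp: schur_class_def fock_zero_space)
  moreover have "(\<lambda>_ :: 'n list \<Rightarrow> 'e. 0 :: 'n list \<Rightarrow> 'f) \<in> schur_class {0} {0}"
    using scaleC_add_right[of _ 0 0]
    by (auto simp: schur_class_iff bounded_ops_def intertwining_def fock_zero_space fock_zero(2)
        fun_eq_iff)
  ultimately show ?thesis by blast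
qed

section \<open>Assembly of the cases |c| = 1 and |c| < 1\<close>

theorem theorem4p1:
  fixes T :: "('n::finite list \<Rightarrow> complex) \<Rightarrow> ('n list \<Rightarrow> complex)"
    and C Cs :: "complex \<Rightarrow> complex"
    and D Ds :: "complex set"
  assumes "T \<in> schur_class UNIV UNIV"
  defines "C \<equiv> entry00 T"
    and "Cs \<equiv> cadjoint C"
    and "D \<equiv> defect_space C"
    and "Ds \<equiv> defect_space Cs"
  shows "\<exists>!T1 :: ('n list \<Rightarrow> complex ^ 'n) \<Rightarrow> ('n list \<Rightarrow> complex).
    T1 \<in> schur_class (copies D) Ds \<and>
    invertible_op D (id_op D - (Phi Ds D (row0 (- Cs)) \<circ> T1 \<circ> translation D)) \<and>
    T = Phi UNIV UNIV (row0 C) +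
      (Phi Ds UNIV (row0 (defect_op Cs)) \<circ> T1 \<circ> translation D \<circ>
       inverse_op D (id_op D - (Phi Ds D (row0 (- Cs)) \<circ> T1 \<circ> translation D)) \<circ>
       Phi UNIV D (row0 (defect_op C)))"
proof -
  define c where "c = T (vacuum 1) []"
  define d where "d = complex_of_real (sqrt (1 - (cmod c)\<^sup>2))"
  have B: "T \<in> bounded_ops UNIV UNIV"
    and contr: "\<And>x. x \<in> fock UNIV \<Longrightarrow> fock_norm (T x) \<le> fock_norm x"
    using assms(1) by (auto simp: schur_class_iff)
  have v: "(vacuum 1 :: 'n list \<Rightarrow> complex) \<in> fock UNIV"
    by (rule level_in_fock[OF vacuum_level]) auto
  have c: "cmod c \<le> 1"
    using norm_le_fock_norm[OF bounded_opsD(1)[OF B v], of "[]"] contr[OF v]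
      fock_norm_vacuum[of "1 :: complex", where 'n = 'n]
    by (simp add: c_def)
  have C: "C = (\<lambda>z. c * z)" unfolding C_def c_def by (rule entry00_scalar[OF B])
  have Cs: "Cs = (\<lambda>z. cnj c * z)" by (simp add: Cs_def C cadjoint_mult)
  have mCs: "- Cs = (\<lambda>z. (- cnj c) * z)" by (auto simp: Cs)
  have dC: "defect_op C = (\<lambda>z. d * z)" and dCs: "defect_op Cs = (\<lambda>z. d * z)"
    using c by (simp_all add: C Cs defect_op_mult d_def)
  have D: "D = (if cmod c = 1 then {0} else UNIV)" and Ds: "Ds = (if cmod c = 1 then {0} else UNIV)"
    using c by (simp_all add: D_def Ds_def C Cs defect_space_mult)
  show ?thesis
  proof (cases "cmod c = 1")
    case True
    have d0: "d = 0" by (simp add: d_def True)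
    have D0: "D = {0}" "Ds = {0}" "copies D = ({0} :: (complex ^ 'n) set)"
      using D Ds True by (auto simp: copies_def vec_eq_iff)
    have P1: "Phi {0} {0} (row0 (\<lambda>z. - cnj c * z)) = (\<lambda>x :: 'n list \<Rightarrow> complex. 0)"
      by (subst Phi_row0_mult) (auto simp: fock_zero_space fun_eq_iff)
    have P2: "Phi {0} UNIV (row0 (\<lambda>z. 0 * z)) = (\<lambda>x :: 'n list \<Rightarrow> complex. 0)"
      by (subst Phi_row0_mult) (auto simp: fun_eq_iff)
    have A: "id_op D - (Phi Ds D (row0 (- Cs)) \<circ> R \<circ> translation D) = (\<lambda>x. 0)"
      for R :: "('n list \<Rightarrow> complex ^ 'n) \<Rightarrow> ('n list \<Rightarrow> complex)"
      unfolding D0 mCs P1 by (auto simp: id_op_def fock_zero_space fun_eq_iff)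
    \<comment> \<open>On the zero space the identity is the zero operator, which is therefore its
      own inverse.\<close>
    have "inverse_ops D (\<lambda>x :: 'n list \<Rightarrow> complex. 0) (\<lambda>x. 0)"
      by (auto simp: inverse_ops_def bounded_ops_def D0 fock_zero_space id_op_def scaleC_complex_def
          fock_zero(2) fun_eq_iff)
    then have inv: "invertible_op D (\<lambda>x :: 'n list \<Rightarrow> complex. 0)"
      by (auto simp: invertible_op_def)
    have "T = scalar_op c" by (rule schur_extremal[OF assms(1) c_def[symmetric] True])
    \<comment> \<open>The outer factor with \<open>d = 0\<close> kills the second summand whatever
      stands to its right, so the formula holds for every \<open>R\<close>.\<close>
    then have "T = Phi UNIV UNIV (row0 C) + (Phi Ds UNIV (row0 (defect_op Cs)) \<circ> R \<circ> S)"
      for R :: "('n list \<Rightarrow> complex ^ 'n) \<Rightarrow> ('n list \<Rightarrow> complex)" and S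
      unfolding dCs d0 D0 P2 unfolding C Phi_row0_scalar by (auto simp: fun_eq_iff)
    then show ?thesis
      unfolding A using inv by (simp add: D0(2,3) schur_class_zero_space comp_assoc)
  next
    case False
    interpret schur_function T c
      using assms(1) c False by unfold_locales (simp_all add: c_def)
    have U: "D = UNIV" "Ds = UNIV" "copies UNIV = (UNIV :: (complex ^ 'n) set)"
      using False D Ds by (auto simp: copies_def)
    have d: "d = defect" by (simp add: d_def defect_def)
    \<comment> \<open>\<open>A\<close> and \<open>rhs\<close> hold for every \<open>R\<close>, so
      that the whole uniqueness claim, and not just its instance at \<open>T1\<close>, turns into
      one about \<open>feedback\<close> and \<open>realization\<close>.\<close>
    have A: "id_op D - (Phi Ds D (row0 (- Cs)) \<circ> R \<circ> translation D) = feedback R"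
      for R :: "('n list \<Rightarrow> complex ^ 'n) \<Rightarrow> ('n list \<Rightarrow> complex)"
      unfolding U mCs Phi_row0_scalar feedback_def ..
    have rhs: "Phi UNIV UNIV (row0 C) + (Phi Ds UNIV (row0 (defect_op Cs)) \<circ> R \<circ> translation D \<circ>
       inverse_op D (feedback R) \<circ> Phi UNIV D (row0 (defect_op C))) = realization R"
      for R :: "('n list \<Rightarrow> complex ^ 'n) \<Rightarrow> ('n list \<Rightarrow> complex)"
      unfolding U dC dCs d unfolding C Phi_row0_scalar realization_def ..
    have inv: "invertible_op UNIV (feedback T1)"
      using inverse_ops_feedback_T1 by (auto simp: invertible_op_def)
    show ?thesis
      unfolding A rhs unfolding U
    proof (rule ex1I[of _ T1])
      show "T1 \<in> schur_class UNIV UNIV \<and> invertible_op UNIV (feedback T1) \<and> T = realization T1"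
        using T1_schur inv realization_T1 by blast
    next
      fix R
      assume "R \<in> schur_class UNIV UNIV \<and> invertible_op UNIV (feedback R) \<and> T = realization R"
      then show "R = T1" by (intro realization_unique) (simp_all add: schur_class_def)
    qed
  qed
qed

end
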